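(* Let $M$ be a closed connected Riemannian manifold and $\boldsymbol{\alpha}$ a magnetic potential (smooth real $1$-form) on $M$. For any nonzero smooth function $f:M\to\mathbb{C}$, $$\int_0^\infty\Big(\iota^{\boldsymbol{\alpha}}\big(\Omega^f(\sqrt t)\big)+\mathrm{area}\big(\partial\Omega^f(\sqrt t)\big)\Big)\,dt\;\le\;2\sqrt2\int_M|f|\cdot|(d+i\boldsymbol{\alpha})f|\,dx,$$ where $\Omega^f(\sqrt t)=\{x\in M\mid\sqrt t\le|f(x)|\}$.
   Context: $dx$ is the Riemannian measure, $\mathrm{vol}$ the Riemannian volume, and norms of complex-valued $1$-forms are those induced by the Riemannian metric. For a nonempty Borel set $\Omega\subseteq M$, the frustration index is $$\iota^{\boldsymbol{\alpha}}(\Omega)=\inf_{\tau\in C^\infty(\Omega,U(1))}\int_\Omega|(d+i\boldsymbol{\alpha})\tau|\,dx,$$ where $U(1)=\{z\in\mathbb{C}\mid|z|=1\}$ and $C^\infty(\Omega,U(1))$ is the set of smooth maps $\Omega\to U(1)$ (smooth on a non-open set in the usual sense of extending smoothly near each point). The boundary measure is $\mathrm{area}(\partial\Omega)=\liminf_{r\to0^+}\frac{\mathrm{vol}(\Omega_r)-\mathrm{vol}(\Omega)}{r}$, with $\Omega_r$ the open $r$-neighborhood of $\Omega$. For $t>\max|f|^2$ the set $\Omega^f(\sqrt t)$ is empty and the integrand on the left is $0$. *)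

theory Defs
  imports "HOL-Analysis.Analysis"
begin

section \<open>Smooth maps between open subsets of normed spaces\<close>

text \<open>Only meant for open \<open>S\<close>. In finite dimensions, continuity of the derivative is
  the same as continuity of all directional derivatives, which is what the recursion uses.\<close>

primrec Ck_on ::
  "nat \<Rightarrow> 'a::real_normed_vector set \<Rightarrow> ('a \<Rightarrow> 'b::real_normed_vector) \<Rightarrow> bool" where
  "Ck_on 0 S f \<longleftrightarrow> continuous_on S f"
| "Ck_on (Suc k) S f \<longleftrightarrow>
     (\<forall>x\<in>S. f differentiable (at x)) \<and>
     (\<forall>v. Ck_on k S (\<lambda>x. frechet_derivative f (at x) v))"

definition smooth_on ::
  "'a::real_normed_vector set \<Rightarrow> ('a \<Rightarrow> 'b::real_normed_vector) \<Rightarrow> bool" where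
  "smooth_on S f \<longleftrightarrow> (\<forall>k. Ck_on k S f)"

section \<open>Smooth manifolds\<close>

text \<open>A manifold is a whole type \<open>'m\<close> of class \<open>{t2_space, second_countable_topology}\<close>
  with a smooth atlas. The atlas need not be maximal. A chart is its domain together with the
  coordinate map, whose values outside the domain are irrelevant.\<close>

type_synonym ('m, 'n) chart = "'m set \<times> ('m \<Rightarrow> real^'n)"

definition chart_inv :: "('m, 'n) chart \<Rightarrow> real^'n \<Rightarrow> 'm" where
  "chart_inv c = inv_into (fst c) (snd c)"

definition transition :: "('m, 'n) chart \<Rightarrow> ('m, 'n) chart \<Rightarrow> real^'n \<Rightarrow> real^'n" where
  "transition c d = snd d \<circ> chart_inv c"

definition smooth_atlas ::
  "('m::topological_space, 'n::finite) chart set \<Rightarrow> bool" where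
  "smooth_atlas \<A> \<longleftrightarrow>
     (\<forall>c\<in>\<A>. open (fst c) \<and> open (snd c ` fst c) \<and>
             homeomorphism (fst c) (snd c ` fst c) (snd c) (chart_inv c)) \<and>
     (\<Union>c\<in>\<A>. fst c) = UNIV \<and>
     (\<forall>c\<in>\<A>. \<forall>d\<in>\<A>. smooth_on (snd c ` (fst c \<inter> fst d)) (transition c d))"

text \<open>Quantities at a point are computed in an arbitrary chart around it. They do not depend
  on that choice, by the transformation laws below.\<close>

definition chart_at :: "('m, 'n) chart set \<Rightarrow> 'm \<Rightarrow> ('m, 'n) chart" where
  "chart_at \<A> p = (SOME c. c \<in> \<A> \<and> p \<in> fst c)"

definition smooth_fun_on_open ::
  "('m::topological_space, 'n::finite) chart set \<Rightarrow> 'm set \<Rightarrow> ('m \<Rightarrow> complex) \<Rightarrow> bool" where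
  "smooth_fun_on_open \<A> W f \<longleftrightarrow>
     open W \<and> (\<forall>c\<in>\<A>. smooth_on (snd c ` (fst c \<inter> W)) (f \<circ> chart_inv c))"

definition smooth_fun_on ::
  "('m::topological_space, 'n::finite) chart set \<Rightarrow> 'm set \<Rightarrow> ('m \<Rightarrow> complex) \<Rightarrow> bool" where
  "smooth_fun_on \<A> \<Omega> f \<longleftrightarrow>
     (\<forall>p\<in>\<Omega>. \<exists>W h. p \<in> W \<and> smooth_fun_on_open \<A> W h \<and> (\<forall>q\<in>W \<inter> \<Omega>. h q = f q))"

section \<open>Tensors in coordinates\<close>

text \<open>\<open>jac c d p\<close> has entries \<open>\<partial>d\<^sub>i / \<partial>c\<^sub>j\<close> at \<open>p\<close>, where \<open>c\<^sub>j\<close> and \<open>d\<^sub>i\<close> are the coordinate functions.\<close>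

definition jac ::
  "('m, 'n::finite) chart \<Rightarrow> ('m, 'n) chart \<Rightarrow> 'm \<Rightarrow> real^'n^'n" where
  "jac c d p = jacobian (transition c d) (at (snd c p))"

text \<open>\<open>g c p\<close> is the matrix \<open>(g\<^sub>i\<^sub>j(p))\<close> of the metric in the coordinates of \<open>c\<close>;
  it is only relevant for \<open>p \<in> fst c\<close>.\<close>

type_synonym ('m, 'n) metric = "('m, 'n) chart \<Rightarrow> 'm \<Rightarrow> real^'n^'n"

definition riemannian_metric ::
  "('m::topological_space, 'n::finite) chart set \<Rightarrow> ('m, 'n) metric \<Rightarrow> bool" where
  "riemannian_metric \<A> g \<longleftrightarrow>
     (\<forall>c\<in>\<A>. smooth_on (snd c ` fst c) (g c \<circ> chart_inv c)) \<and>
     (\<forall>c\<in>\<A>. \<forall>p\<in>fst c. transpose (g c p) = g c p \<and>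
        (\<forall>v. v \<noteq> 0 \<longrightarrow> 0 < v \<bullet> (g c p *v v))) \<and>
     (\<forall>c\<in>\<A>. \<forall>d\<in>\<A>. \<forall>p\<in>fst c \<inter> fst d.
        g c p = transpose (jac c d p) ** g d p ** jac c d p)"

text \<open>\<open>\<alpha> c p\<close> is the vector of components of the 1-form with respect to the coordinate
  differentials of \<open>c\<close> at \<open>p\<close>.\<close>

type_synonym ('m, 'n) one_form = "('m, 'n) chart \<Rightarrow> 'm \<Rightarrow> real^'n"

definition smooth_one_form ::
  "('m::topological_space, 'n::finite) chart set \<Rightarrow> ('m, 'n) one_form \<Rightarrow> bool" where
  "smooth_one_form \<A> \<alpha> \<longleftrightarrow>
     (\<forall>c\<in>\<A>. smooth_on (snd c ` fst c) (\<alpha> c \<circ> chart_inv c)) \<and>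
     (\<forall>c\<in>\<A>. \<forall>d\<in>\<A>. \<forall>p\<in>fst c \<inter> fst d. \<alpha> c p = transpose (jac c d p) *v \<alpha> d p)"

text \<open>The Hermitian norm \<open>(\<Sum> g\<^sup>j\<^sup>k \<omega>\<^sub>j cnj \<omega>\<^sub>k)\<^sup>1\<^sup>/\<^sup>2\<close> on complex covectors at \<open>p\<close>, with
  \<open>\<omega>\<close> given by its components in \<open>c\<close>; the sum is real, as the matrix is symmetric.\<close>

definition covector_norm ::
  "('m, 'n::finite) metric \<Rightarrow> ('m, 'n) chart \<Rightarrow> 'm \<Rightarrow> complex^'n \<Rightarrow> real" where
  "covector_norm g c p \<omega> =
     sqrt (Re (\<Sum>j\<in>UNIV. \<Sum>k\<in>UNIV.
       complex_of_real (matrix_inv (g c p) $ j $ k) * \<omega> $ j * cnj (\<omega> $ k)))"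

text \<open>The components in \<open>c\<close> of \<open>(d + i\<alpha>)\<tau>\<close> at \<open>p \<in> \<Omega>\<close>, for \<open>\<tau>\<close> defined on \<open>\<Omega>\<close>. For open \<open>\<Omega>\<close>
  the derivative is the ordinary one. For \<open>\<tau>\<close> smooth on a Borel set \<open>\<Omega>\<close>, the
  derivative within \<open>\<Omega>\<close> is unique at every Lebesgue density point of \<open>\<Omega>\<close>, hence almost everywhere
  on \<open>\<Omega>\<close>, and there it is the derivative of any local smooth extension. On the remaining
  null set \<open>frechet_derivative\<close> picks an arbitrary value, which does not affect integrals over
  \<open>\<Omega>\<close>.\<close>

definition magnetic_diff ::
  "('m, 'n::finite) one_form \<Rightarrow> 'm set \<Rightarrow> ('m \<Rightarrow> complex) \<Rightarrow> ('m, 'n) chart \<Rightarrow> 'm \<Rightarrow> complex^'n" where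
  "magnetic_diff \<alpha> \<Omega> \<tau> c p =
     (\<chi> j. frechet_derivative (\<tau> \<circ> chart_inv c) (at (snd c p) within snd c ` (fst c \<inter> \<Omega>)) (axis j 1)
           + \<i> * complex_of_real (\<alpha> c p $ j) * \<tau> p)"

definition magnetic_norm ::
  "('m, 'n::finite) chart set \<Rightarrow> ('m, 'n) metric \<Rightarrow> ('m, 'n) one_form
    \<Rightarrow> 'm set \<Rightarrow> ('m \<Rightarrow> complex) \<Rightarrow> 'm \<Rightarrow> real" where
  "magnetic_norm \<A> g \<alpha> \<Omega> \<tau> p =
     covector_norm g (chart_at \<A> p) p (magnetic_diff \<alpha> \<Omega> \<tau> (chart_at \<A> p) p)"

section \<open>Riemannian measure and distance\<close>

text \<open>The unique Borel measure given by \<open>(det g)\<^sup>1\<^sup>/\<^sup>2 dy\<close> in every chart.\<close>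

definition riemannian_measure ::
  "('m::topological_space, 'n::finite) chart set \<Rightarrow> ('m, 'n) metric \<Rightarrow> 'm measure" where
  "riemannian_measure \<A> g = (THE \<mu>. sets \<mu> = sets borel \<and>
     (\<forall>c\<in>\<A>. \<forall>B\<in>sets borel. B \<subseteq> fst c \<longrightarrow>
        emeasure \<mu> B =
          (\<integral>\<^sup>+ y\<in>snd c ` B. ennreal (sqrt (det (g c (chart_inv c y)))) \<partial>lborel)))"

text \<open>Curves are parametrised by \<open>{0..1}\<close>. Breakpoints (where the velocity need not exist)
  are allowed as in \<open>piecewise_C1_differentiable_on\<close>.\<close>

definition piecewise_C1_curve ::
  "('m::topological_space, 'n::finite) chart set \<Rightarrow> (real \<Rightarrow> 'm) \<Rightarrow> bool" where
  "piecewise_C1_curve \<A> \<gamma> \<longleftrightarrow> path \<gamma> \<and>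
     (\<forall>c\<in>\<A>. \<forall>a b. {a..b} \<subseteq> {0..1} \<and> \<gamma> ` {a..b} \<subseteq> fst c \<longrightarrow>
        (snd c \<circ> \<gamma>) piecewise_C1_differentiable_on {a..b})"

definition curve_speed ::
  "('m, 'n::finite) chart set \<Rightarrow> ('m, 'n) metric \<Rightarrow> (real \<Rightarrow> 'm) \<Rightarrow> real \<Rightarrow> real" where
  "curve_speed \<A> g \<gamma> t =
     (let c = chart_at \<A> (\<gamma> t); v = vector_derivative (snd c \<circ> \<gamma>) (at t)
      in sqrt (v \<bullet> (g c (\<gamma> t) *v v)))"

definition curve_length ::
  "('m, 'n::finite) chart set \<Rightarrow> ('m, 'n) metric \<Rightarrow> (real \<Rightarrow> 'm) \<Rightarrow> ennreal" where
  "curve_length \<A> g \<gamma> = (\<integral>\<^sup>+ t\<in>{0..1}. ennreal (curve_speed \<A> g \<gamma> t) \<partial>lborel)"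

definition riemannian_dist ::
  "('m::topological_space, 'n::finite) chart set \<Rightarrow> ('m, 'n) metric \<Rightarrow> 'm \<Rightarrow> 'm \<Rightarrow> ennreal" where
  "riemannian_dist \<A> g p q =
     (INF \<gamma>\<in>{\<gamma>. piecewise_C1_curve \<A> \<gamma> \<and> pathstart \<gamma> = p \<and> pathfinish \<gamma> = q}.
        curve_length \<A> g \<gamma>)"

definition open_neighbourhood ::
  "('m::topological_space, 'n::finite) chart set \<Rightarrow> ('m, 'n) metric \<Rightarrow> real \<Rightarrow> 'm set \<Rightarrow> 'm set" where
  "open_neighbourhood \<A> g r \<Omega> = {p. \<exists>q\<in>\<Omega>. riemannian_dist \<A> g p q < ennreal r}"

section \<open>Frustration index, boundary measure, superlevel sets\<close>

definition frustration_index ::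
  "('m::topological_space, 'n::finite) chart set \<Rightarrow> ('m, 'n) metric \<Rightarrow> ('m, 'n) one_form
    \<Rightarrow> 'm set \<Rightarrow> ennreal" where
  "frustration_index \<A> g \<alpha> \<Omega> =
     (INF \<tau>\<in>{\<tau>. smooth_fun_on \<A> \<Omega> \<tau> \<and> (\<forall>p\<in>\<Omega>. cmod (\<tau> p) = 1)}.
        \<integral>\<^sup>+ p\<in>\<Omega>. ennreal (magnetic_norm \<A> g \<alpha> \<Omega> \<tau> p) \<partial>riemannian_measure \<A> g)"

definition boundary_area ::
  "('m::topological_space, 'n::finite) chart set \<Rightarrow> ('m, 'n) metric \<Rightarrow> 'm set \<Rightarrow> ennreal" where
  "boundary_area \<A> g \<Omega> =
     Liminf (at_right 0) (\<lambda>r.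
       (emeasure (riemannian_measure \<A> g) (open_neighbourhood \<A> g r \<Omega>)
         - emeasure (riemannian_measure \<A> g) \<Omega>) / ennreal r)"

definition superlevel :: "('m \<Rightarrow> complex) \<Rightarrow> real \<Rightarrow> 'm set" where
  "superlevel f s = {p. s \<le> cmod (f p)}"

end

theory Submission
  imports Defs
begin

text \<open>Write \<open>F = \<bar>f\<bar>\<^sup>2\<close> and test the frustration index of \<open>{F \<ge> t}\<close> with \<open>\<tau> = f / \<bar>f\<bar>\<close>. By Tonelli, the first
  part of the left-hand side is at most \<open>\<integral> F \<bar>(d + i\<alpha>)\<tau>\<bar>\<close>. For the second part, a curve of length less than \<open>r\<close>
  raises \<open>F\<close> by at most \<open>r (\<bar>dF\<bar> + \<epsilon>)\<close>, uniformly by compactness, so the \<open>r\<close>-neighbourhood of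
  \<open>{F \<ge> t}\<close> lies in \<open>{F + r (\<bar>dF\<bar> + \<epsilon>) \<ge> t}\<close>; Tonelli and Fatou bound the integral of the boundary
  areas by \<open>\<integral> \<bar>dF\<bar>\<close>. Pointwise, \<open>cnj f (d + i\<alpha>)f\<close> has real part \<open>dF / 2\<close> and an imaginary part \<open>J\<close> of norm
  \<open>F \<bar>(d + i\<alpha>)\<tau>\<bar>\<close>, and \<open>\<bar>J\<bar> + \<bar>dF\<bar> \<le> 2 \<surd>2 (\<bar>dF\<bar>\<^sup>2 / 4 + \<bar>J\<bar>\<^sup>2)\<^sup>1\<^sup>/\<^sup>2\<close>.

  The Riemannian measure is given by a definite description, so its existence and uniqueness
  have to be established through the change of variables formula.\<close>

section \<open>Calculus of \<open>C\<^sup>k\<close> maps\<close>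

text \<open>The boundary area is a lower limit of Minkowski type, so the co-area inequality needs
  neither Sard's theorem nor Hausdorff measures, only growth of \<open>F\<close> along short curves.
  The test map has one weak point: on the level \<open>F = t\<close> its derivative within the
  superlevel set may be an arbitrary choice, and this level need not be null for a given
  \<open>t\<close>. It is null for almost every \<open>t\<close>, which is all that the outer
  integral sees. Measurability in \<open>t\<close> is not established for the frustration index or
  the boundary area; the integral on the left is compared with that of measurable majorants by
  monotonicity, and only the latter is split into two parts. Much of the remaining work comes from
  \<open>chart_at\<close>, whose choice may jump from point to point: covector norms and speeds have
  to be rewritten in a fixed chart before continuity or calculus can be applied.\<close>

lemma frechet_derivative_eq:
  assumes "(f has_derivative f') (at x)"
  shows "frechet_derivative f (at x) = f'"
  using frechet_derivative_at[OF assms] by simp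

text \<open>On an open set the values determine the derivative, so agreement passes down through the
  recursion even if the functions differ elsewhere.\<close>

lemma Ck_on_cong:
  assumes "open S" "\<And>x. x \<in> S \<Longrightarrow> f x = g x" "Ck_on k S f"
  shows "Ck_on k S g"
  using assms(2,3)
proof (induction k arbitrary: f g)
  case 0
  then show ?case by (simp cong: continuous_on_cong)
next
  case (Suc k)
  have der: "(g has_derivative frechet_derivative f (at x)) (at x)" if "x \<in> S" for x
  proof (rule has_derivative_transform_within_open[OF _ assms(1) that])
    show "(f has_derivative frechet_derivative f (at x)) (at x)"
      using Suc.prems(2) that by (simp add: frechet_derivative_works[symmetric])
  qed (use Suc.prems(1) in auto)
  then have "frechet_derivative g (at x) = frechet_derivative f (at x)" if "x \<in> S" for x
    using that by (simp add: frechet_derivative_eq)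
  then have "Ck_on k S (\<lambda>x. frechet_derivative g (at x) v)" for v
    using Suc.prems(2) by - (rule Suc.IH[of "\<lambda>x. frechet_derivative f (at x) v"], auto)
  with der show ?case by (auto simp: differentiable_def)
qed

text \<open>Lets an explicit candidate replace the chosen \<open>frechet_derivative\<close>, so that
  sums, products and powers can be treated by induction on the order.\<close>

lemma Ck_on_Suc_intro:
  assumes "open S"
    and der: "\<And>x. x \<in> S \<Longrightarrow> (f has_derivative f' x) (at x)"
    and "\<And>v. Ck_on k S (\<lambda>x. f' x v)"
  shows "Ck_on (Suc k) S f"
proof -
  have "frechet_derivative f (at x) = f' x" if "x \<in> S" for x
    using der[OF that] by (rule frechet_derivative_eq)
  then have "Ck_on k S (\<lambda>x. frechet_derivative f (at x) v)" for v
    by (intro Ck_on_cong[OF assms(1) _ assms(3)[of v]]) simp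
  with der show ?thesis by (auto simp: differentiable_def)
qed

lemma Ck_on_subset: "Ck_on k S f \<Longrightarrow> T \<subseteq> S \<Longrightarrow> Ck_on k T f"
  by (induction k arbitrary: f) (auto intro: continuous_on_subset)

lemma Ck_on_imp_continuous: "Ck_on k S f \<Longrightarrow> continuous_on S f"
proof (cases k)
  case (Suc j)
  assume "Ck_on k S f"
  with Suc have "\<forall>x\<in>S. isCont f x"
    by (auto intro: differentiable_imp_continuous_within)
  then show ?thesis by (rule continuous_at_imp_continuous_on)
qed simp

lemma Ck_on_Suc_imp: "Ck_on (Suc k) S f \<Longrightarrow> Ck_on k S f"
proof (induction k arbitrary: f)
  case 0
  then have "continuous_on S f" by (rule Ck_on_imp_continuous)
  then show ?case by simp
next
  case (Suc k)
  note prems = Suc.prems[unfolded Ck_on.simps(2)[of "Suc k"]]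
  show ?case
    unfolding Ck_on.simps(2)[of k] using prems Suc.IH by blast
qed

text \<open>The recursion differentiates at \<open>x\<close> in the whole space, never within
  \<open>S\<close>, so each of its clauses is local. This glues the local extensions through which
  \<open>smooth_fun_on\<close> describes smoothness.\<close>

lemma Ck_on_local:
  assumes "\<And>x. x \<in> S \<Longrightarrow> \<exists>T. open T \<and> x \<in> T \<and> Ck_on k T f"
  shows "Ck_on k S f"
  using assms
proof (induction k arbitrary: f)
  case 0
  have "isCont f x" if "x \<in> S" for x
  proof -
    obtain T where "open T" "x \<in> T" "continuous_on T f" using 0 \<open>x \<in> S\<close> unfolding Ck_on.simps by blast
    then show ?thesis by (simp add: continuous_on_eq_continuous_at)
  qed
  then show ?case by (auto intro!: continuous_at_imp_continuous_on)
next
  case (Suc k)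
  have "f differentiable (at x)" if "x \<in> S" for x
    using Suc.prems[OF that] unfolding Ck_on.simps by blast
  moreover have "Ck_on k S (\<lambda>x. frechet_derivative f (at x) v)" for v
    using Suc.prems unfolding Ck_on.simps by (intro Suc.IH) blast
  ultimately show ?case unfolding Ck_on.simps by blast
qed

lemma Ck_on_has_derivative:
  "Ck_on (Suc k) S f \<Longrightarrow> x \<in> S \<Longrightarrow> (f has_derivative frechet_derivative f (at x)) (at x)"
  by (simp add: frechet_derivative_works[symmetric])

lemma Ck_on_add:
  assumes "open S" "Ck_on k S f" "Ck_on k S g"
  shows "Ck_on k S (\<lambda>x. f x + g x)"
  using assms(2,3)
proof (induction k arbitrary: f g)
  case 0
  then show ?case by (auto intro: continuous_intros)
next
  case (Suc k)
  have "((\<lambda>x. f x + g x) has_derivative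
      (\<lambda>v. frechet_derivative f (at x) v + frechet_derivative g (at x) v)) (at x)"
    if "x \<in> S" for x
    using Suc.prems that by (intro has_derivative_add Ck_on_has_derivative)
  then show ?case
    using Suc by (intro Ck_on_Suc_intro[OF assms(1)]) auto
qed

lemma Ck_on_bounded_linear:
  assumes "open S" "bounded_linear h" "Ck_on k S f"
  shows "Ck_on k S (\<lambda>x. h (f x))"
  using assms(3)
proof (induction k arbitrary: f)
  case 0
  then show ?case
    using assms(2) by (auto intro: bounded_linear.continuous_on)
next
  case (Suc k)
  have "((\<lambda>x. h (f x)) has_derivative (\<lambda>v. h (frechet_derivative f (at x) v))) (at x)"
    if "x \<in> S" for x
    using Suc.prems that by (intro bounded_linear.has_derivative[OF assms(2)] Ck_on_has_derivative)
  then show ?case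
    using Suc by (intro Ck_on_Suc_intro[OF assms(1)]) auto
qed

lemma Ck_on_mult:
  fixes f g :: "'a::real_normed_vector \<Rightarrow> 'b::real_normed_algebra"
  assumes "open S" "Ck_on k S f" "Ck_on k S g"
  shows "Ck_on k S (\<lambda>x. f x * g x)"
  using assms(2,3)
proof (induction k arbitrary: f g)
  case 0
  then show ?case by (auto intro: continuous_intros)
next
  case (Suc k)
  have "((\<lambda>x. f x * g x) has_derivative
      (\<lambda>v. f x * frechet_derivative g (at x) v + frechet_derivative f (at x) v * g x)) (at x)"
    if "x \<in> S" for x
    using Suc.prems that by (intro has_derivative_mult Ck_on_has_derivative)
  moreover have "Ck_on k S f" "Ck_on k S g"
    using Suc.prems by (auto intro: Ck_on_Suc_imp)
  ultimately show ?case
    using Suc assms(1) by (intro Ck_on_Suc_intro[where f' = "\<lambda>x v. f x * frechet_derivative g (at x) v +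
        frechet_derivative f (at x) v * g x"] Ck_on_add) auto
qed

text \<open>Differentiation produces the exponent \<open>a - 1\<close>, hence the induction with
  \<open>a\<close> arbitrary.\<close>

lemma Ck_on_powr:
  fixes f :: "'a::real_normed_vector \<Rightarrow> real"
  assumes "open S" "Ck_on k S f" "\<And>x. x \<in> S \<Longrightarrow> 0 < f x"
  shows "Ck_on k S (\<lambda>x. f x powr a)"
  using assms(2)
proof (induction k arbitrary: a)
  case 0
  then show ?case using assms(3) by (auto intro!: continuous_intros simp: less_imp_neq[symmetric])
next
  case (Suc k)
  have "((\<lambda>x. f x powr a) has_derivative
      (\<lambda>v. a * (f x powr (a - 1) * frechet_derivative f (at x) v))) (at x)"
    if "x \<in> S" for x
  proof -
    have "((\<lambda>y. y powr a) has_derivative (*) (a * f x powr (a - 1))) (at (f x))"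
      using has_real_derivative_powr[OF assms(3)[OF that], of a]
      by (simp add: has_field_derivative_def)
    from diff_chain_at[OF Ck_on_has_derivative[OF Suc.prems that] this]
    show ?thesis by (simp add: o_def mult.assoc)
  qed
  moreover have "Ck_on k S f"
    using Suc.prems by (rule Ck_on_Suc_imp)
  ultimately show ?case
    using Suc assms(1) by (intro Ck_on_Suc_intro[where f' = "\<lambda>x v. a * (f x powr (a - 1) * frechet_derivative f (at x) v)"]
        Ck_on_bounded_linear[OF _ bounded_linear_mult_right] Ck_on_mult) auto
qed

text \<open>The squared modulus is \<open>f * cnj f\<close>, a product of smooth functions, and it
  is positive; so \<open>sgn f\<close> is \<open>f\<close> times a smooth power of it, with exponent
  -1/2.\<close>

lemma smooth_on_sgn:
  fixes f :: "'a::real_normed_vector \<Rightarrow> complex"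
  assumes "open S" "smooth_on S f" "\<And>x. x \<in> S \<Longrightarrow> f x \<noteq> 0"
  shows "smooth_on S (\<lambda>x. sgn (f x))"
  unfolding smooth_on_def
proof
  fix k
  have f: "Ck_on k S f" using assms(2) by (simp add: smooth_on_def)
  have "Ck_on k S (\<lambda>x. Re (f x * cnj (f x)))"
    using assms(1) f
    by (intro Ck_on_bounded_linear[OF _ bounded_linear_Re] Ck_on_mult Ck_on_bounded_linear[OF _ bounded_linear_cnj])
  then have "Ck_on k S (\<lambda>x. (cmod (f x))\<^sup>2)"
    by (simp add: complex_mult_cnj cmod_power2)
  then have "Ck_on k S (\<lambda>x. ((cmod (f x))\<^sup>2) powr (-1/2))"
    using assms by (intro Ck_on_powr) auto
  then have "Ck_on k S (\<lambda>x. f x * of_real (((cmod (f x))\<^sup>2) powr (-1/2)))"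
    using assms(1) f by (intro Ck_on_mult Ck_on_bounded_linear[OF _ bounded_linear_of_real])
  then show "Ck_on k S (\<lambda>x. sgn (f x))"
  proof (rule Ck_on_cong[OF assms(1), rotated])
    fix x assume "x \<in> S"
    then have "0 < cmod (f x)" using assms(3) by simp
    then have "((cmod (f x))\<^sup>2) powr (-1/2) = 1 / cmod (f x)"
      by (simp add: powr_minus_divide[of _ "1/2", simplified] powr_half_sqrt)
    then show "f x * of_real (((cmod (f x))\<^sup>2) powr (-1/2)) = sgn (f x)"
      by (simp add: sgn_eq)
  qed
qed

section \<open>Quadratic forms on covectors\<close>

definition pos_def :: "real^'n^'n \<Rightarrow> bool" where
  "pos_def G \<longleftrightarrow> transpose G = G \<and> (\<forall>v. v \<noteq> 0 \<longrightarrow> 0 < v \<bullet> (G *v v))"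

text \<open>For positive definite \<open>G\<close>, the square of the norm on covectors that is dual
  to the norm \<open>sqrt (v \<bullet> (G *v v))\<close> on vectors.\<close>

definition cosq :: "real^'n^'n \<Rightarrow> real^'n \<Rightarrow> real" where
  "cosq G w = w \<bullet> (matrix_inv G *v w)"

lemma inverse_matrix_inv:
  fixes G :: "real^'n^'n"
  assumes "invertible G"
  shows "G ** matrix_inv G = mat 1" "matrix_inv G ** G = mat 1"
proof -
  have "G ** matrix_inv G = mat 1 \<and> matrix_inv G ** G = mat 1"
    unfolding matrix_inv_def using assms unfolding invertible_def by (rule someI_ex)
  then show "G ** matrix_inv G = mat 1" "matrix_inv G ** G = mat 1" by auto
qed

lemma pos_def_invertible:
  assumes "pos_def G"
  shows "invertible G"
proof -
  have "v = 0" if "G *v v = 0" for v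
    using assms that unfolding pos_def_def by fastforce
  then show ?thesis
    unfolding invertible_left_inverse matrix_left_invertible_ker by simp
qed

lemma pos_def_det: "pos_def G \<Longrightarrow> det G \<noteq> 0"
  using pos_def_invertible invertible_det_nz by blast

lemma pos_def_mult_inv:
  assumes "pos_def G"
  shows "G *v (matrix_inv G *v w) = w" "matrix_inv G *v (G *v w) = w"
  using inverse_matrix_inv[OF pos_def_invertible[OF assms]]
  by (simp_all add: matrix_vector_mul_assoc)

lemma pos_def_inner_commute:
  assumes "pos_def G"
  shows "v \<bullet> (G *v w) = w \<bullet> (G *v v)"
proof -
  have "v \<bullet> (G *v w) = (transpose G *v v) \<bullet> w"
    by (metis dot_lmul_matrix transpose_matrix_vector)
  then show ?thesis using assms by (simp only: pos_def_def inner_commute)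
qed

lemma pos_def_nonneg: "pos_def G \<Longrightarrow> 0 \<le> v \<bullet> (G *v v)"
  by (cases "v = 0") (auto simp: pos_def_def less_imp_le)

lemma cosq_eq: "pos_def G \<Longrightarrow> cosq G w = (matrix_inv G *v w) \<bullet> (G *v (matrix_inv G *v w))"
  by (simp add: cosq_def pos_def_mult_inv inner_commute)

lemma cosq_nonneg: "pos_def G \<Longrightarrow> 0 \<le> cosq G w"
  by (simp add: cosq_eq pos_def_nonneg)

lemma cosq_scale: "cosq G (k *\<^sub>R w) = k\<^sup>2 * cosq G w"
  by (simp add: cosq_def matrix_vector_mult_scaleR power2_eq_square)

lemma cosq_zero [simp]: "cosq G 0 = 0"
  by (simp add: cosq_def)

text \<open>The form of \<open>G\<close> is nonnegative on \<open>w - t *\<^sub>R v\<close>, where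
  \<open>w\<close> is the vector dual to \<open>u\<close>. The inequality later turns a bound on a
  differential into a bound on the growth along a curve.\<close>

lemma cosq_Cauchy_Schwarz:
  assumes "pos_def G"
  shows "u \<bullet> v \<le> sqrt (cosq G u) * sqrt (v \<bullet> (G *v v))"
proof (cases "v = 0")
  case False
  define w where "w = matrix_inv G *v u"
  define q where "q = v \<bullet> (G *v v)"
  \<comment> \<open>The minimiser of the form on the line of all
    \<open>w - t *\<^sub>R v\<close>.\<close>
  define t where "t = (u \<bullet> v) / q"
  have q: "0 < q" using False assms by (simp add: q_def pos_def_def)
  have Gw: "G *v w = u" by (simp add: w_def pos_def_mult_inv[OF assms])
  have "0 \<le> (w - t *\<^sub>R v) \<bullet> (G *v (w - t *\<^sub>R v))"
    using assms by (rule pos_def_nonneg)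
  also have "\<dots> = w \<bullet> (G *v w) - t * (w \<bullet> (G *v v)) - t * (v \<bullet> (G *v w)) + t * t * q"
    by (simp add: matrix_vector_mult_diff_distrib matrix_vector_mult_scaleR inner_diff_left
        inner_diff_right q_def algebra_simps)
  also have "\<dots> = cosq G u - 2 * t * (u \<bullet> v) + t * t * q"
    using pos_def_inner_commute[OF assms, of w v] Gw
    by (simp add: cosq_def inner_commute w_def[symmetric])
  also have "\<dots> = cosq G u - (u \<bullet> v)\<^sup>2 / q"
    using q by (simp add: t_def power2_eq_square field_simps)
  finally have "(u \<bullet> v)\<^sup>2 \<le> cosq G u * q"
    using q by (simp add: field_simps)
  then show ?thesis
    by (metis q_def real_le_rsqrt real_sqrt_mult)
qed simp

text \<open>In the case of a coordinate change, \<open>J\<close> is the Jacobian and \<open>w\<close> a covector.\<close>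

lemma cosq_transform:
  fixes J :: "real^'n^'n"
  assumes "pos_def G" "pos_def H" and G: "G = transpose J ** H ** J"
  shows "cosq G (transpose J *v w) = cosq H w"
proof -
  have "det J \<noteq> 0"
    using pos_def_det[OF assms(1)] by (auto simp: G det_mul)
  then have "invertible (transpose J)"
    by (simp add: invertible_det_nz)
  then obtain K where K: "K ** transpose J = mat 1"
    unfolding invertible_def by blast
  \<comment> \<open>The vector dual to the pulled-back covector. Cancelling
    \<open>transpose J\<close> shows that \<open>J\<close> carries it to the vector dual to
    \<open>w\<close> under \<open>H\<close>.\<close>
  define z where "z = matrix_inv G *v (transpose J *v w)"
  have "transpose J *v (H *v (J *v z)) = transpose J *v w"
    using pos_def_mult_inv(1)[OF assms(1), of "transpose J *v w"]
    by (simp add: z_def G matrix_vector_mul_assoc matrix_mul_assoc)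
  then have "K *v (transpose J *v (H *v (J *v z))) = K *v (transpose J *v w)"
    by simp
  then have "H *v (J *v z) = w"
    using K by (simp only: matrix_vector_mul_assoc matrix_mul_assoc matrix_mul_lid matrix_vector_mul_lid)
  then have "J *v z = matrix_inv H *v w"
    using pos_def_mult_inv(2)[OF assms(2), of "J *v z"] by simp
  moreover have "cosq G (transpose J *v w) = w \<bullet> (J *v z)"
    by (simp add: cosq_def z_def dot_lmul_matrix flip: vector_transpose_matrix)
  ultimately show ?thesis by (simp add: cosq_def)
qed

lemma continuous_on_det:
  fixes A :: "'a::topological_space \<Rightarrow> real^'n^'n"
  assumes "continuous_on S A"
  shows "continuous_on S (\<lambda>x. det (A x))"
  unfolding det_def using assms by (intro continuous_intros)

text \<open>\<open>matrix_inv\<close> is defined by choice, which hides how it depends on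
  \<open>G\<close>. Quotients of determinants make the continuity in \<open>G\<close>
  visible.\<close>

lemma matrix_inv_vector_cramer:
  fixes G :: "real^'n^'n"
  assumes "det G \<noteq> 0"
  shows "matrix_inv G *v w = (\<chi> k. det (\<chi> i j. if j = k then w $ i else G $ i $ j) / det G)"
proof -
  have "G *v (matrix_inv G *v w) = w"
    using inverse_matrix_inv(1)[of G] assms
    by (simp add: matrix_vector_mul_assoc invertible_det_nz)
  then show ?thesis using cramer[OF assms] by blast
qed

lemma continuous_on_cosq:
  fixes G :: "'a::topological_space \<Rightarrow> real^'n^'n"
  assumes G: "continuous_on S G" and w: "continuous_on S w" and d: "\<And>x. x \<in> S \<Longrightarrow> pos_def (G x)"
  shows "continuous_on S (\<lambda>x. cosq (G x) (w x))"
proof -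
  have entry: "continuous_on S (\<lambda>x. \<chi> i j. if j = k then w x $ i else G x $ i $ j)" for k
  proof (intro continuous_on_vec_lambda)
    fix i j
    show "continuous_on S (\<lambda>x. if j = k then w x $ i else G x $ i $ j)"
      using G w by (cases "j = k") (auto intro!: continuous_intros)
  qed
  have "continuous_on S (\<lambda>x. w x \<bullet>
      (\<chi> k. det (\<chi> i j. if j = k then w x $ i else G x $ i $ j) / det (G x)))"
    using d pos_def_det
    by (intro continuous_on_inner w continuous_on_vec_lambda continuous_on_divide continuous_on_det
        entry G) auto
  moreover have "cosq (G x) (w x) = w x \<bullet>
      (\<chi> k. det (\<chi> i j. if j = k then w x $ i else G x $ i $ j) / det (G x))" if "x \<in> S" for x
    unfolding cosq_def matrix_inv_vector_cramer[OF pos_def_det[OF d[OF that]]] ..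
  ultimately show ?thesis
    by (simp cong: continuous_on_cong)
qed

text \<open>The real part of \<open>\<omega> $ j * cnj (\<omega> $ k)\<close> is the product of the
  real parts plus that of the imaginary parts, so the Hermitian form splits into two real
  ones.\<close>

lemma covector_norm_eq:
  assumes "pos_def (g c p)"
  shows "covector_norm g c p \<omega> =
    sqrt (cosq (g c p) (\<chi> j. Re (\<omega> $ j)) + cosq (g c p) (\<chi> j. Im (\<omega> $ j)))"
proof -
  let ?H = "matrix_inv (g c p)"
  have "Re (of_real (?H $ j $ k) * \<omega> $ j * cnj (\<omega> $ k)) =
      Re (\<omega> $ j) * (?H $ j $ k * Re (\<omega> $ k)) + Im (\<omega> $ j) * (?H $ j $ k * Im (\<omega> $ k))" for j k
    by (simp add: algebra_simps)
  then show ?thesis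
    by (simp add: covector_norm_def cosq_def inner_vec_def matrix_vector_mult_def sum_distrib_left
        sum.distrib mult.assoc mult.left_commute)
qed

text \<open>Applied twice: with the factor \<open>cnj (f p)\<close> to separate modulus and phase of
  the magnetic differential of \<open>f\<close>, and with \<open>\<i> * f p\<close> over the cube of
  the modulus for that of \<open>sgn f\<close>.\<close>

lemma covector_norm_scale:
  "covector_norm g c p (\<chi> j. z * \<omega> $ j) = cmod z * covector_norm g c p \<omega>"
proof -
  have "of_real a * (z * \<omega> $ j) * cnj (z * \<omega> $ k) =
      of_real ((cmod z)\<^sup>2) * (of_real a * \<omega> $ j * cnj (\<omega> $ k))" for a j k
    unfolding complex_norm_square complex_cnj_mult by (simp only: ac_simps)
  then have "(\<Sum>j\<in>UNIV. \<Sum>k\<in>UNIV. complex_of_real (matrix_inv (g c p) $ j $ k)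
        * (\<chi> j. z * \<omega> $ j) $ j * cnj ((\<chi> j. z * \<omega> $ j) $ k)) =
      of_real ((cmod z)\<^sup>2) * (\<Sum>j\<in>UNIV. \<Sum>k\<in>UNIV. complex_of_real (matrix_inv (g c p) $ j $ k)
        * \<omega> $ j * cnj (\<omega> $ k))"
    by (simp only: vec_lambda_beta sum_distrib_left)
  then show ?thesis
    by (simp only: covector_norm_def Re_complex_of_real real_sqrt_mult real_sqrt_abs abs_norm_cancel
        times_complex.sel Im_complex_of_real mult_zero_left diff_zero)
qed

section \<open>Change of variables for nonnegative integrals\<close>

text \<open>A bridge from Lebesgue absolute integrability, the language of the library's change of
  variables, to extended nonnegative integrals over \<open>lborel\<close>. Measurability is asked of
  the product with the indicator, since \<open>h\<close> is controlled on \<open>S\<close>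
  only.\<close>

lemma absolutely_integrable_on_nonneg:
  fixes h :: "'a::euclidean_space \<Rightarrow> real"
  assumes m: "(\<lambda>x. indicator S x * h x) \<in> borel_measurable borel"
    and nonneg: "\<And>x. x \<in> S \<Longrightarrow> 0 \<le> h x"
  shows "h absolutely_integrable_on S \<longleftrightarrow> (\<integral>\<^sup>+x\<in>S. ennreal (h x) \<partial>lborel) < \<infinity>"
    and "h absolutely_integrable_on S \<Longrightarrow> ennreal (integral S h) = (\<integral>\<^sup>+x\<in>S. ennreal (h x) \<partial>lborel)"
proof -
  let ?q = "\<lambda>x. indicator S x * h x"
  have q: "0 \<le> ?q x" for x using nonneg by (auto simp: indicator_def)
  have eq: "ennreal (h x) * indicator S x = ennreal (?q x)" for x
    by (auto simp: indicator_def)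
  have iff: "h absolutely_integrable_on S \<longleftrightarrow> integrable lborel ?q"
    using m by (simp add: set_integrable_def integrable_completion)
  also have "\<dots> \<longleftrightarrow> (\<integral>\<^sup>+x. ennreal (?q x) \<partial>lborel) < \<infinity>"
    using m q by (simp add: integrable_iff_bounded)
  finally show "h absolutely_integrable_on S \<longleftrightarrow> (\<integral>\<^sup>+x\<in>S. ennreal (h x) \<partial>lborel) < \<infinity>"
    by (simp only: eq)
  assume h: "h absolutely_integrable_on S"
  have "integral S h = set_lebesgue_integral lebesgue S h"
    using set_lebesgue_integral_eq_integral(2)[OF h] by simp
  also have "\<dots> = integral\<^sup>L lborel ?q"
    using m by (simp add: set_lebesgue_integral_def integral_completion)
  finally show "ennreal (integral S h) = (\<integral>\<^sup>+x\<in>S. ennreal (h x) \<partial>lborel)"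
    using nn_integral_eq_integral[of lborel ?q] q h iff by (simp only: eq) simp
qed

text \<open>The library gives, for each finite value, an equivalence between the two integrals
  existing with that value. If one exists, the values agree; otherwise neither exists, and by
  nonnegativity both sides are infinite.\<close>

lemma nn_integral_change_of_variables_wellorder:
  fixes \<psi> :: "real^'n::{finite,wellorder} \<Rightarrow> real^'n::_" and h k :: "real^'n::_ \<Rightarrow> real"
  assumes S: "S \<in> sets borel"
    and der: "\<And>x. x \<in> S \<Longrightarrow> (\<psi> has_derivative \<psi>' x) (at x within S)"
    and inj: "inj_on \<psi> S"
    and mh: "(\<lambda>y. indicator (\<psi> ` S) y * h y) \<in> borel_measurable borel"
    and mk: "(\<lambda>x. indicator S x * k x) \<in> borel_measurable borel"
    and h: "\<And>y. y \<in> \<psi> ` S \<Longrightarrow> 0 \<le> h y"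
    and k: "\<And>x. x \<in> S \<Longrightarrow> \<bar>det (matrix (\<psi>' x))\<bar> * h (\<psi> x) = k x"
  shows "(\<integral>\<^sup>+y\<in>\<psi> ` S. ennreal (h y) \<partial>lborel) = (\<integral>\<^sup>+x\<in>S. ennreal (k x) \<partial>lborel)"
proof -
  \<comment> \<open>The library theorem concerns vector-valued integrands, so real functions are
    wrapped into \<open>real^1\<close>.\<close>
  let ?f = "\<lambda>y. vec (h y) :: real^1" and ?D = "\<lambda>x. \<bar>det (matrix (\<psi>' x))\<bar> *\<^sub>R (vec (h (\<psi> x)) :: real^1)"
  have "S \<in> sets lebesgue" using S by simp
  note cov = has_absolute_integral_change_of_variables[OF this der inj, of ?f]
  have f: "?f absolutely_integrable_on \<psi> ` S \<longleftrightarrow> h absolutely_integrable_on \<psi> ` S"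
    "\<And>b. integral (\<psi> ` S) ?f = vec b \<longleftrightarrow> integral (\<psi> ` S) h = b"
    by (simp_all add: absolutely_integrable_on_1_iff integral_on_1_eq vec_eq_iff)
  have Dk: "?D absolutely_integrable_on S \<longleftrightarrow> k absolutely_integrable_on S"
    unfolding absolutely_integrable_on_1_iff
    by (rule set_integrable_cong) (use k in auto)
  have Dk': "integral S ?D = vec b \<longleftrightarrow> integral S k = b" for b
  proof -
    have "integral S (\<lambda>x. ?D x $ 1) = integral S k"
      by (rule Henstock_Kurzweil_Integration.integral_cong) (use k in auto)
    then show ?thesis by (simp add: integral_on_1_eq vec_eq_iff)
  qed
  have k0: "0 \<le> k x" if "x \<in> S" for x
    using h[of "\<psi> x"] k[OF that] that by (metis abs_ge_zero imageI mult_nonneg_nonneg)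
  have key: "k absolutely_integrable_on S \<and> integral S k = b \<longleftrightarrow>
      h absolutely_integrable_on \<psi> ` S \<and> integral (\<psi> ` S) h = b" for b
    using cov[of "vec b"] f Dk Dk' by blast
  note h' = absolutely_integrable_on_nonneg[OF mh h]
  note k' = absolutely_integrable_on_nonneg[OF mk k0]
  show ?thesis
  proof (cases "k absolutely_integrable_on S")
    case True
    then show ?thesis using key h'(2) k'(2) by metis
  next
    case False
    then have "\<not> h absolutely_integrable_on \<psi> ` S" using key by blast
    then show ?thesis using False h'(1) k'(1) by (metis infinity_ennreal_def top.not_eq_extremum)
  qed
qed

text \<open>The library states its change of variables theorem for well-ordered index types, so the
  coordinates are relabelled by natural numbers.\<close>

typedef ('a::finite) idx = "{..<CARD('a)}"
  by (rule exI[of _ 0]) simp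

instantiation idx :: (finite) linorder
begin

definition less_eq_idx :: "'a idx \<Rightarrow> 'a idx \<Rightarrow> bool" where
  "less_eq_idx i j \<longleftrightarrow> Rep_idx i \<le> Rep_idx j"

definition less_idx :: "'a idx \<Rightarrow> 'a idx \<Rightarrow> bool" where
  "less_idx i j \<longleftrightarrow> Rep_idx i < Rep_idx j"

instance
  by standard (auto simp: less_eq_idx_def less_idx_def Rep_idx_inject)

end

lemma range_Rep_idx: "range (Rep_idx :: 'a::finite idx \<Rightarrow> nat) = {..<CARD('a)}"
  using type_definition.Rep_range[OF type_definition_idx] .

instance idx :: (finite) finite
proof
  have "finite (range (Rep_idx :: 'a idx \<Rightarrow> nat))"
    by (simp add: range_Rep_idx)
  then show "finite (UNIV :: 'a idx set)"
    by (rule finite_imageD) (simp add: inj_on_def Rep_idx_inject)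
qed

instance idx :: (finite) wellorder
proof
  fix P :: "'a idx \<Rightarrow> bool" and a :: "'a idx"
  assume step: "\<And>x. (\<And>y. y < x \<Longrightarrow> P y) \<Longrightarrow> P x"
  show "P a"
    by (induction a rule: measure_induct_rule[of Rep_idx]) (auto intro: step simp: less_idx_def)
qed

lemma bij_idx_exists: "\<exists>f :: 'a::finite idx \<Rightarrow> 'a. bij f"
proof -
  have "card (range (Rep_idx :: 'a idx \<Rightarrow> nat)) = CARD('a idx)"
    by (rule card_image) (simp add: inj_on_def Rep_idx_inject)
  then have "CARD('a idx) = CARD('a)" by (simp add: range_Rep_idx)
  then show ?thesis
    using finite_same_card_bij[of "UNIV :: 'a idx set" "UNIV :: 'a set"] by auto
qed

section \<open>Invariance of Lebesgue measure and determinants under relabelling of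
  coordinates\<close>

definition relabel :: "('b \<Rightarrow> 'a) \<Rightarrow> real^'a \<Rightarrow> real^'b" where
  "relabel f x = (\<chi> i. x $ f i)"

lemma relabel_inverse:
  assumes "bij f"
  shows "relabel f (relabel (inv f) y) = y" "relabel (inv f) (relabel f x) = x"
  using assms by (simp_all add: relabel_def bij_is_inj bij_is_surj surj_f_inv_f)

lemma linear_relabel: "linear (relabel (f :: 'b::finite \<Rightarrow> 'a::finite))"
  by (rule linearI) (simp_all add: relabel_def vec_eq_iff)

lemma continuous_on_relabel: "continuous_on A (relabel (f :: 'b::finite \<Rightarrow> 'a::finite))"
  by (rule linear_continuous_on) (simp add: linear_conv_bounded_linear[symmetric] linear_relabel)

lemma measurable_relabel [measurable]:
  "relabel (f :: 'b::finite \<Rightarrow> 'a::finite) \<in> borel_measurable borel"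
  by (intro borel_measurable_continuous_onI continuous_on_relabel)

lemma relabel_image_eq_vimage:
  assumes "bij f"
  shows "relabel f ` S = relabel (inv f) -` S"
  using relabel_inverse[OF assms] by (auto simp: image_iff) metis

lemma prod_Basis_vec:
  fixes w :: "real^'a \<Rightarrow> real"
  shows "(\<Prod>b\<in>Basis. w b) = (\<Prod>i\<in>UNIV. w (axis i 1))"
proof -
  have B: "Basis = (\<lambda>i::'a. axis i (1::real)) ` UNIV"
    by (auto simp: Basis_vec_def)
  have "inj (\<lambda>i::'a. axis i (1::real))"
    by (auto simp: inj_on_def axis_eq_axis)
  then show ?thesis unfolding B by (rule prod.reindex_cong) simp_all
qed

text \<open>Lebesgue measure is determined by the volumes of boxes, and relabelling only permutes
  the side lengths.\<close>

lemma distr_lborel_relabel: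
  fixes f :: "'b::finite \<Rightarrow> 'a::finite"
  assumes "bij f"
  shows "distr lborel borel (relabel f) = (lborel :: (real^'b) measure)"
proof (rule lborel_eqI[symmetric])
  fix l u :: "real^'b"
  assume le: "\<And>b. b \<in> Basis \<Longrightarrow> l \<bullet> b \<le> u \<bullet> b"
  let ?Q = "relabel (inv f)"
  have le': "l $ i \<le> u $ i" for i
    using le[of "axis i 1"] by (simp add: inner_axis axis_in_Basis_iff)
  have ff: "inv f (f i) = i" "f (inv f j) = j" for i j
    using assms by (simp_all add: bij_is_inj bij_is_surj surj_f_inv_f)
  have "relabel f -` box l u = box (?Q l) (?Q u)"
  proof (rule set_eqI)
    fix x :: "real^'a"
    have "(\<forall>i. l $ i < x $ f i \<and> x $ f i < u $ i) \<longleftrightarrow>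
        (\<forall>j. l $ inv f j < x $ j \<and> x $ j < u $ inv f j)"
      by (metis ff)
    then show "x \<in> relabel f -` box l u \<longleftrightarrow> x \<in> box (?Q l) (?Q u)"
      by (simp add: mem_box_cart relabel_def)
  qed
  then have "emeasure (distr lborel borel (relabel f)) (box l u) = emeasure lborel (box (?Q l) (?Q u))"
    by (simp add: emeasure_distr)
  also have "\<dots> = (\<Prod>b\<in>Basis. (?Q u - ?Q l) \<bullet> b)"
    using le' by (intro emeasure_lborel_box) (auto simp: Basis_vec_def inner_axis relabel_def)
  also have "(\<Prod>b\<in>Basis. (?Q u - ?Q l) \<bullet> b) = (\<Prod>j\<in>UNIV. u $ inv f j - l $ inv f j)"
    by (simp add: prod_Basis_vec inner_axis relabel_def)
  also have "\<dots> = (\<Prod>i\<in>UNIV. u $ i - l $ i)"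
    by (rule prod.reindex_bij_betw[of "inv f"]) (use assms in \<open>simp add: bij_imp_bij_inv\<close>)
  also have "\<dots> = (\<Prod>b\<in>Basis. (u - l) \<bullet> b)"
    by (simp add: prod_Basis_vec inner_axis)
  finally show "emeasure (distr lborel borel (relabel f)) (box l u) = (\<Prod>b\<in>Basis. (u - l) \<bullet> b)" .
qed simp

text \<open>Conjugation with \<open>f\<close> is a sign-preserving bijection between the
  permutations of the two index types; it reindexes the Leibniz sum.\<close>

lemma det_relabel:
  fixes f :: "'b::finite \<Rightarrow> 'a::finite" and A :: "real^'a^'a"
  assumes "bij f"
  shows "det (\<chi> i j. A $ f i $ f j) = det A"
proof -
  have inj: "inj f" and bij: "bij_betw f UNIV UNIV" using assms by (auto simp: bij_is_inj)
  let ?m = "map_permutation UNIV f"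
  have m: "bij_betw ?m {p. p permutes (UNIV :: 'b set)} {p. p permutes (UNIV :: 'a set)}"
  proof (rule bij_betwI[where g = "map_permutation UNIV (inv f)"])
    show "?m \<in> {p. p permutes UNIV} \<rightarrow> {p. p permutes UNIV}"
      using map_permutation_permutes[OF bij] by auto
    show "map_permutation UNIV (inv f) \<in> {p. p permutes UNIV} \<rightarrow> {p. p permutes UNIV}"
      using map_permutation_permutes[OF bij_imp_bij_inv[OF assms]] by auto
    show "map_permutation UNIV (inv f) (?m p) = p" if "p \<in> {p. p permutes UNIV}" for p
      using assms
      by (simp add: fun_eq_iff map_permutation_def restrict_id_def bij_is_surj bij_is_inj surj_f_inv_f
          inv_inv_eq bij_imp_bij_inv)
    show "?m (map_permutation UNIV (inv f) p) = p" if "p \<in> {p. p permutes UNIV}" for p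
      using assms
      by (simp add: fun_eq_iff map_permutation_def restrict_id_def bij_is_surj bij_is_inj surj_f_inv_f
          inv_inv_eq bij_imp_bij_inv)
  qed
  have "det A = (\<Sum>p | p permutes (UNIV :: 'b set). of_int (sign (?m p)) * (\<Prod>i\<in>UNIV. A $ i $ ?m p i))"
    unfolding det_def by (rule sum.reindex_bij_betw[OF m, symmetric])
  also have "\<dots> = (\<Sum>p | p permutes (UNIV :: 'b set). of_int (sign p) * (\<Prod>i\<in>UNIV. A $ f i $ f (p i)))"
  proof (rule sum.cong[OF refl])
    fix p :: "'b \<Rightarrow> 'b" assume "p \<in> {p. p permutes UNIV}"
    then have "sign (?m p) = sign p"
      using inj by (intro sign_map_permutation) auto
    moreover have "(\<Prod>i\<in>UNIV. A $ i $ ?m p i) = (\<Prod>i\<in>UNIV. A $ f i $ ?m p (f i))"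
      by (rule prod.reindex_bij_betw[OF bij, symmetric])
    moreover have "?m p (f i) = f (p i)" for i
      using inj by (intro map_permutation_apply) auto
    ultimately show "of_int (sign (?m p)) * (\<Prod>i\<in>UNIV. A $ i $ ?m p i) =
        of_int (sign p) * (\<Prod>i\<in>UNIV. A $ f i $ f (p i))" by simp
  qed
  also have "\<dots> = det (\<chi> i j. A $ f i $ f j)"
    by (simp add: det_def)
  finally show ?thesis ..
qed

lemma nn_integral_relabel:
  fixes f :: "'b::finite \<Rightarrow> 'a::finite" and h :: "real^'a \<Rightarrow> real"
  assumes "bij f" and m: "(\<lambda>x. indicator S x * h x) \<in> borel_measurable borel"
  shows "(\<integral>\<^sup>+y\<in>relabel f ` S. ennreal (h (relabel (inv f) y)) \<partial>lborel) = (\<integral>\<^sup>+x\<in>S. ennreal (h x) \<partial>lborel)"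
proof -
  have bi: "bij (inv f)" using assms(1) by (rule bij_imp_bij_inv)
  have eq: "ennreal (h x) * indicator S x = ennreal (indicator S x * h x)" for x
    by (auto simp: indicator_def)
  have "(\<integral>\<^sup>+x\<in>S. ennreal (h x) \<partial>lborel) =
      (\<integral>\<^sup>+x\<in>S. ennreal (h x) \<partial>distr lborel borel (relabel (inv f)))"
    by (simp add: distr_lborel_relabel[OF bi])
  also have "\<dots> = (\<integral>\<^sup>+y. ennreal (h (relabel (inv f) y)) * indicator S (relabel (inv f) y) \<partial>lborel)"
    using m by (intro nn_integral_distr) (simp_all add: eq)
  also have "\<dots> = (\<integral>\<^sup>+y\<in>relabel f ` S. ennreal (h (relabel (inv f) y)) \<partial>lborel)"
    by (simp add: relabel_image_eq_vimage[OF assms(1)] indicator_vimage[symmetric] o_def)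
  finally show ?thesis ..
qed

text \<open>Conjugating \<open>\<psi>\<close> with the relabelling moves everything to a
  well-ordered index type. Rows and columns of the Jacobian matrix are relabelled alike, so its
  determinant stays the same.\<close>

lemma nn_integral_change_of_variables:
  fixes \<psi> :: "real^'n \<Rightarrow> real^'n" and h k :: "real^'n \<Rightarrow> real"
  assumes S: "S \<in> sets borel"
    and der: "\<And>x. x \<in> S \<Longrightarrow> (\<psi> has_derivative \<psi>' x) (at x within S)"
    and inj: "inj_on \<psi> S"
    and mh: "(\<lambda>y. indicator (\<psi> ` S) y * h y) \<in> borel_measurable borel"
    and mk: "(\<lambda>x. indicator S x * k x) \<in> borel_measurable borel"
    and h: "\<And>y. y \<in> \<psi> ` S \<Longrightarrow> 0 \<le> h y"
    and k: "\<And>x. x \<in> S \<Longrightarrow> \<bar>det (matrix (\<psi>' x))\<bar> * h (\<psi> x) = k x"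
  shows "(\<integral>\<^sup>+y\<in>\<psi> ` S. ennreal (h y) \<partial>lborel) = (\<integral>\<^sup>+x\<in>S. ennreal (k x) \<partial>lborel)"
proof -
  obtain f :: "'n idx \<Rightarrow> 'n" where f: "bij f" using bij_idx_exists by blast
  let ?P = "relabel f" and ?Q = "relabel (inv f)"
  note PQ = relabel_inverse[OF f]
  define \<phi> where "\<phi> = ?P \<circ> \<psi> \<circ> ?Q"
  define \<phi>' where "\<phi>' = (\<lambda>y. ?P \<circ> \<psi>' (?Q y) \<circ> ?Q)"
  have QS: "?Q ` (?P ` S) = S" by (simp add: image_image PQ)
  have img: "\<phi> ` (?P ` S) = ?P ` (\<psi> ` S)" by (simp add: \<phi>_def image_image PQ)
  have ind: "indicator (?P ` T) y = (indicator T (?Q y) :: real)" for T y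
    by (simp add: relabel_image_eq_vimage[OF f] indicator_def)
  have "(\<integral>\<^sup>+y\<in>\<psi> ` S. ennreal (h y) \<partial>lborel) =
      (\<integral>\<^sup>+y\<in>\<phi> ` (?P ` S). ennreal (h (?Q y)) \<partial>lborel)"
    unfolding img by (rule nn_integral_relabel[OF f mh, symmetric])
  also have "\<dots> = (\<integral>\<^sup>+x\<in>?P ` S. ennreal (k (?Q x)) \<partial>lborel)"
  proof (rule nn_integral_change_of_variables_wellorder[where \<psi>' = \<phi>'])
    show "?P ` S \<in> sets borel"
      using measurable_sets[OF measurable_relabel S, of "inv f"]
      by (simp add: relabel_image_eq_vimage[OF f])
    show "(\<phi> has_derivative \<phi>' y) (at y within ?P ` S)" if "y \<in> ?P ` S" for y
    proof -
      have Q: "(?Q has_derivative ?Q) (at y within ?P ` S)"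
        and P: "(?P has_derivative ?P) (at z within Z)" for z Z
        using linear_relabel by (auto intro!: linear_imp_has_derivative)
      have "?Q y \<in> S" using that by (auto simp: PQ)
      then have "(\<psi> has_derivative \<psi>' (?Q y)) (at (?Q y) within ?Q ` (?P ` S))"
        unfolding QS by (rule der)
      from diff_chain_within[OF diff_chain_within[OF Q this] P]
      show ?thesis by (simp add: \<phi>_def \<phi>'_def o_assoc)
    qed
    show "inj_on \<phi> (?P ` S)"
      using inj by (auto simp: inj_on_def \<phi>_def PQ) (metis PQ(2))
    show "(\<lambda>y. indicator (\<phi> ` (?P ` S)) y * h (?Q y)) \<in> borel_measurable borel"
      unfolding img ind using measurable_compose[OF measurable_relabel mh] .
    show "(\<lambda>x. indicator (?P ` S) x * k (?Q x)) \<in> borel_measurable borel"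
      unfolding ind using measurable_compose[OF measurable_relabel mk] .
    show "0 \<le> h (?Q y)" if "y \<in> \<phi> ` (?P ` S)" for y
      using that h unfolding img by (auto simp: PQ)
    show "\<bar>det (matrix (\<phi>' x))\<bar> * h (?Q (\<phi> x)) = k (?Q x)" if "x \<in> ?P ` S" for x
    proof -
      have "?Q (axis j 1) = axis (f j) 1" for j
        using f by (auto simp: relabel_def axis_def vec_eq_iff bij_is_inj bij_is_surj surj_f_inv_f
            inv_f_eq)
      then have "matrix (\<phi>' x) = (\<chi> i j. matrix (\<psi>' (?Q x)) $ f i $ f j)"
        by (simp add: \<phi>'_def matrix_def relabel_def vec_eq_iff)
      then have "det (matrix (\<phi>' x)) = det (matrix (\<psi>' (?Q x)))"
        using det_relabel[OF f] by metis
      moreover have "?Q x \<in> S" using that by (auto simp: PQ)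
      ultimately show ?thesis using k[of "?Q x"] by (simp add: \<phi>_def PQ)
    qed
  qed
  also have "\<dots> = (\<integral>\<^sup>+x\<in>S. ennreal (k x) \<partial>lborel)"
    by (rule nn_integral_relabel[OF f mk])
  finally show ?thesis .
qed

section \<open>Charts and tensors\<close>

locale compact_riemannian =
  fixes \<A> :: "('m::{t2_space, second_countable_topology}, 'n::finite) chart set"
    and g :: "('m, 'n) metric"
  assumes atlas: "smooth_atlas \<A>"
    and compact_UNIV: "compact (UNIV :: 'm set)"
    and metric: "riemannian_metric \<A> g"
begin

lemma
  assumes "c \<in> \<A>"
  shows open_chart: "open (fst c)"
    and open_chart_range: "open (snd c ` fst c)"
    and chart_homeo: "homeomorphism (fst c) (snd c ` fst c) (snd c) (chart_inv c)"
  using assms atlas by (auto simp: smooth_atlas_def)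

lemma
  assumes "c \<in> \<A>"
  shows chart_inv_chart: "p \<in> fst c \<Longrightarrow> chart_inv c (snd c p) = p"
    and chart_chart_inv: "y \<in> snd c ` fst c \<Longrightarrow> snd c (chart_inv c y) = y"
    and chart_inv_in: "y \<in> snd c ` fst c \<Longrightarrow> chart_inv c y \<in> fst c"
    and continuous_on_chart: "continuous_on (fst c) (snd c)"
    and continuous_on_chart_inv: "continuous_on (snd c ` fst c) (chart_inv c)"
  using chart_homeo[OF assms] by (auto simp: homeomorphism_def)

lemma chart_cover: "\<exists>c\<in>\<A>. p \<in> fst c"
  using atlas unfolding smooth_atlas_def by blast

lemma chart_at_in: "chart_at \<A> p \<in> \<A>" and in_chart_at: "p \<in> fst (chart_at \<A> p)"
proof -
  have "chart_at \<A> p \<in> \<A> \<and> p \<in> fst (chart_at \<A> p)"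
    unfolding chart_at_def by (rule someI_ex) (use chart_cover in blast)
  then show "chart_at \<A> p \<in> \<A>" "p \<in> fst (chart_at \<A> p)" by auto
qed

text \<open>Images under a chart become preimages under its inverse, for which continuity yields
  openness and Borel measurability.\<close>

lemma chart_image_eq:
  assumes "c \<in> \<A>" "W \<subseteq> fst c"
  shows "snd c ` W = snd c ` fst c \<inter> chart_inv c -` W"
  using assms(2) chart_inv_chart[OF assms(1)] chart_chart_inv[OF assms(1)] chart_inv_in[OF assms(1)]
  by (auto simp: image_iff subset_iff)

lemma open_chart_image:
  assumes "c \<in> \<A>" "open W"
  shows "open (snd c ` (fst c \<inter> W))"
proof -
  have "open (snd c ` fst c \<inter> chart_inv c -` (fst c \<inter> W))"
    using continuous_on_chart_inv[OF assms(1)] open_chart_range[OF assms(1)]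
      open_chart[OF assms(1)] assms(2)
    by (intro continuous_open_preimage open_Int)
  then show ?thesis using chart_image_eq[OF assms(1), of "fst c \<inter> W"] by simp
qed

lemma borel_chart_image:
  assumes "c \<in> \<A>" "B \<in> sets borel" "B \<subseteq> fst c"
  shows "snd c ` B \<in> sets borel"
proof -
  have U: "snd c ` fst c \<in> sets borel" using open_chart_range[OF assms(1)] by simp
  have "chart_inv c \<in> borel_measurable (restrict_space borel (snd c ` fst c))"
    using continuous_on_chart_inv[OF assms(1)] by (rule borel_measurable_continuous_on_restrict)
  from measurable_sets[OF this assms(2)]
  have "chart_inv c -` B \<inter> (snd c ` fst c) \<in> sets borel"
    using U by (simp add: space_restrict_space sets_restrict_space_iff)
  then show ?thesis using chart_image_eq[OF assms(1,3)] by (simp add: Int_commute)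
qed

lemma transition_has_derivative:
  assumes "c \<in> \<A>" "d \<in> \<A>" "p \<in> fst c" "p \<in> fst d"
  shows "(transition c d has_derivative (\<lambda>v. jac c d p *v v)) (at (snd c p))"
proof -
  have "Ck_on (Suc 0) (snd c ` (fst c \<inter> fst d)) (transition c d)"
    using assms(1,2) atlas by (simp add: smooth_atlas_def smooth_on_def del: Ck_on.simps)
  then have "transition c d differentiable (at (snd c p))"
    using assms(3,4) by auto
  then show ?thesis by (simp add: jac_def jacobian_works)
qed

lemma transition_chart: "c \<in> \<A> \<Longrightarrow> p \<in> fst c \<Longrightarrow> transition c d (snd c p) = snd d p"
  by (simp add: transition_def chart_inv_chart)

lemma pos_def_metric: "c \<in> \<A> \<Longrightarrow> p \<in> fst c \<Longrightarrow> pos_def (g c p)"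
  using metric unfolding riemannian_metric_def pos_def_def by blast

lemma metric_transform:
  "c \<in> \<A> \<Longrightarrow> d \<in> \<A> \<Longrightarrow> p \<in> fst c \<Longrightarrow> p \<in> fst d \<Longrightarrow>
    g c p = transpose (jac c d p) ** g d p ** jac c d p"
  using metric unfolding riemannian_metric_def by blast

lemma continuous_on_metric: "c \<in> \<A> \<Longrightarrow> continuous_on (snd c ` fst c) (\<lambda>y. g c (chart_inv c y))"
  using metric unfolding riemannian_metric_def smooth_on_def o_def by (metis Ck_on.simps(1))

lemma continuous_on_chart_pullback:
  assumes "c \<in> \<A>" "continuous_on (snd c ` fst c) (\<lambda>y. h (chart_inv c y))"
  shows "continuous_on (fst c) h"
proof -
  have "continuous_on (fst c) (\<lambda>p. h (chart_inv c (snd c p)))"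
    by (rule continuous_on_compose2[OF assms(2) continuous_on_chart[OF assms(1)]]) simp
  then show ?thesis using chart_inv_chart[OF assms(1)] by (simp cong: continuous_on_cong)
qed

section \<open>The Riemannian measure\<close>

text \<open>The truncation provides the nonnegativity asked for by the change of variables without a
  proof that the determinant is positive. As \<open>ennreal\<close> truncates as well, the integrals
  are the same.\<close>

definition chart_density :: "('m, 'n) chart \<Rightarrow> real^'n \<Rightarrow> real" where
  "chart_density c y = max 0 (sqrt (det (g c (chart_inv c y))))"

definition chart_volume :: "('m, 'n) chart \<Rightarrow> 'm set \<Rightarrow> ennreal" where
  "chart_volume c B = (\<integral>\<^sup>+ y\<in>snd c ` B. ennreal (chart_density c y) \<partial>lborel)"

lemma ennreal_chart_density: "ennreal (chart_density c y) = ennreal (sqrt (det (g c (chart_inv c y))))"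
  by (cases "0 \<le> sqrt (det (g c (chart_inv c y)))") (auto simp: chart_density_def max_def ennreal_neg)

lemma continuous_on_chart_density: "c \<in> \<A> \<Longrightarrow> continuous_on (snd c ` fst c) (chart_density c)"
  unfolding chart_density_def
  by (intro continuous_intros continuous_on_det continuous_on_metric)

lemma measurable_chart_density:
  assumes "c \<in> \<A>" "B \<in> sets borel" "B \<subseteq> fst c"
  shows "(\<lambda>y. indicator (snd c ` B) y * chart_density c y) \<in> borel_measurable borel"
proof -
  have "continuous_on (snd c ` B) (chart_density c)"
    using continuous_on_chart_density[OF assms(1)] by (rule continuous_on_subset) (use assms(3) in blast)
  from borel_measurable_continuous_on_indicator[OF borel_chart_image[OF assms] this]
  show ?thesis by simp
qed

text \<open>Writes the chart volume as a genuine measure on coordinate space, from which countable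
  additivity is inherited.\<close>

lemma chart_volume_eq_emeasure:
  assumes "c \<in> \<A>" "B \<in> sets borel" "B \<subseteq> fst c"
  shows "chart_volume c B =
    emeasure (density lborel (\<lambda>y. ennreal (indicator (snd c ` fst c) y * chart_density c y))) (snd c ` B)"
proof -
  have m: "(\<lambda>y. indicator (snd c ` fst c) y * chart_density c y) \<in> borel_measurable borel"
    using assms(1) open_chart by (intro measurable_chart_density) auto
  have "emeasure (density lborel (\<lambda>y. ennreal (indicator (snd c ` fst c) y * chart_density c y))) (snd c ` B)
      = (\<integral>\<^sup>+ y\<in>snd c ` B. ennreal (indicator (snd c ` fst c) y * chart_density c y) \<partial>lborel)"
    using m borel_chart_image[OF assms] by (intro emeasure_density) auto
  also have "\<dots> = chart_volume c B"
    unfolding chart_volume_def using assms(3) by (intro nn_integral_cong) (auto simp: indicator_def)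
  finally show ?thesis ..
qed

text \<open>By the transformation law, \<open>det (g c p)\<close> is the squared Jacobian
  determinant times \<open>det (g d p)\<close>; the square root supplies exactly the Jacobian factor
  of the substitution.\<close>

lemma chart_volume_change:
  assumes cd: "c \<in> \<A>" "d \<in> \<A>" and B: "B \<in> sets borel" "B \<subseteq> fst c" "B \<subseteq> fst d"
  shows "chart_volume c B = chart_volume d B"
proof -
  have img: "transition c d ` (snd c ` B) = snd d ` B"
    using B cd by (force simp: image_image transition_chart)
  have "(\<integral>\<^sup>+ y\<in>transition c d ` (snd c ` B). ennreal (chart_density d y) \<partial>lborel) =
        (\<integral>\<^sup>+ y\<in>snd c ` B. ennreal (chart_density c y) \<partial>lborel)"
  proof (rule nn_integral_change_of_variables[where \<psi>' = "\<lambda>y v. jac c d (chart_inv c y) *v v"])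
    show "snd c ` B \<in> sets borel" using cd B by (intro borel_chart_image)
    show "(transition c d has_derivative (\<lambda>v. jac c d (chart_inv c y) *v v)) (at y within snd c ` B)"
      if y: "y \<in> snd c ` B" for y
    proof -
      obtain p where "p \<in> B" "y = snd c p" using y by auto
      then show ?thesis
        using transition_has_derivative[OF cd, of p] B chart_inv_chart[OF cd(1), of p]
        by (auto simp: subset_iff intro: has_derivative_at_withinI)
    qed
    show "inj_on (transition c d) (snd c ` B)"
    proof (rule inj_onI; clarify)
      fix p q assume pq: "p \<in> B" "q \<in> B" "transition c d (snd c p) = transition c d (snd c q)"
      then have "snd d p = snd d q" using transition_chart cd B by (metis subsetD)
      then show "snd c p = snd c q" using chart_inv_chart[OF cd(2)] pq B by (metis subsetD)
    qed
    show "(\<lambda>y. indicator (transition c d ` (snd c ` B)) y * chart_density d y) \<in> borel_measurable borel"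
      unfolding img using cd B by (intro measurable_chart_density)
    show "(\<lambda>y. indicator (snd c ` B) y * chart_density c y) \<in> borel_measurable borel"
      using cd B by (intro measurable_chart_density)
    show "0 \<le> chart_density d y" for y by (simp add: chart_density_def)
    show "\<bar>det (matrix (\<lambda>v. jac c d (chart_inv c y) *v v))\<bar> * chart_density d (transition c d y) = chart_density c y"
      if y: "y \<in> snd c ` B" for y
    proof -
      obtain p where p: "p \<in> B" "y = snd c p" using y by auto
      have pcd: "p \<in> fst c" "p \<in> fst d" using p B by auto
      have "det (g c p) = (det (jac c d p))\<^sup>2 * det (g d p)"
        using metric_transform[OF cd pcd] by (simp add: det_mul power2_eq_square)
      then have "sqrt (det (g c p)) = \<bar>det (jac c d p)\<bar> * sqrt (det (g d p))"
        by (simp add: real_sqrt_mult)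
      then show ?thesis
        using pcd cd by (simp add: p chart_density_def chart_inv_chart transition_chart max_mult_distrib_left)
    qed
  qed
  then show ?thesis unfolding img chart_volume_def by simp
qed

lemma chart_volume_UN:
  fixes B :: "nat \<Rightarrow> 'm set"
  assumes "c \<in> \<A>" "range B \<subseteq> sets borel" "(\<Union>i. B i) \<subseteq> fst c" "disjoint_family B"
  shows "(\<Sum>i. chart_volume c (B i)) = chart_volume c (\<Union>i. B i)"
proof -
  let ?M = "density lborel (\<lambda>y. ennreal (indicator (snd c ` fst c) y * chart_density c y))"
  have "inj_on (snd c) (fst c)"
    using chart_inv_chart[OF assms(1)] by (metis inj_onI)
  then have disj: "disjoint_family (\<lambda>i. snd c ` B i)"
    using assms(3,4) unfolding disjoint_family_on_def inj_on_def by blast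
  have "(\<Sum>i. emeasure ?M (snd c ` B i)) = emeasure ?M (\<Union>i. snd c ` B i)"
    using disj assms borel_chart_image[OF assms(1)]
    by (intro suminf_emeasure) (auto simp: UN_subset_iff range_subsetD)
  moreover have "chart_volume c (B i) = emeasure ?M (snd c ` B i)" for i
    using assms by (intro chart_volume_eq_emeasure) auto
  moreover have "chart_volume c (\<Union>i. B i) = emeasure ?M (snd c ` (\<Union>i. B i))"
    using assms by (intro chart_volume_eq_emeasure) auto
  ultimately show ?thesis by (simp add: image_UN)
qed

lemma chart_volume_empty [simp]: "chart_volume c {} = 0"
  by (simp add: chart_volume_def)

section \<open>Existence, uniqueness and finiteness of the Riemannian measure\<close>

lemma finite_chart_cover:
  obtains n and c :: "nat \<Rightarrow> ('m, 'n) chart"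
  where "\<And>i. i < n \<Longrightarrow> c i \<in> \<A>" "(\<Union>i<n. fst (c i)) = UNIV"
proof -
  have "\<exists>C'\<subseteq>\<A>. finite C' \<and> UNIV \<subseteq> \<Union>(fst ` C')"
    using compactE_image[OF compact_UNIV, of \<A> fst] open_chart chart_cover by (metis UN_I subsetI)
  then obtain C where C: "C \<subseteq> \<A>" "finite C" "UNIV \<subseteq> \<Union>(fst ` C)" by blast
  from C(2) obtain n c where "C = c ` {i::nat. i < n}"
    using finite_imp_nat_seg_image_inj_on by metis
  with C show ?thesis by (intro that[of n c]) auto
qed

definition is_riemannian_measure :: "'m measure \<Rightarrow> bool" where
  "is_riemannian_measure \<mu> \<longleftrightarrow> sets \<mu> = sets borel \<and>
     (\<forall>c\<in>\<A>. \<forall>B\<in>sets borel. B \<subseteq> fst c \<longrightarrow> emeasure \<mu> B = chart_volume c B)"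

text \<open>The manifold is cut into finitely many disjoint Borel pieces, each inside one chart, and
  the chart volumes of the pieces are added. Independence of the chart makes the sum correct in
  every other chart; any competitor has the same value on each piece.\<close>

lemma riemannian_measure_exists_unique: "\<exists>!\<mu>. is_riemannian_measure \<mu>"
proof -
  obtain n and cs :: "nat \<Rightarrow> ('m, 'n) chart"
    where cs: "\<And>i. i < n \<Longrightarrow> cs i \<in> \<A>" and cover: "(\<Union>i<n. fst (cs i)) = UNIV"
    using finite_chart_cover by blast
  \<comment> \<open>The points for which \<open>cs i\<close> is the first chart of the enumeration
    that contains them.\<close>
  define E where "E i = fst (cs i) - (\<Union>j<i. fst (cs j))" for i
  have E: "E i \<in> sets borel" "E i \<subseteq> fst (cs i)" if "i < n" for i
    using that cs open_chart by (auto simp: E_def intro!: sets.Diff sets.finite_UN)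
  have E_cover: "\<exists>i<n. p \<in> E i" for p
  proof -
    define i where "i = (LEAST i. p \<in> fst (cs i))"
    obtain j where j: "j < n" "p \<in> fst (cs j)" using cover by blast
    then have "p \<in> fst (cs i)" "i \<le> j" unfolding i_def by (auto intro: LeastI Least_le)
    moreover have "p \<notin> fst (cs k)" if "k < i" for k using that not_less_Least i_def by blast
    ultimately show ?thesis using j by (intro exI[of _ i]) (auto simp: E_def)
  qed
  have E_disj: "disjoint_family_on E {..<n}"
  proof -
    have "E i \<inter> E j = {}" if "i < j" for i j
      using that by (auto simp: E_def)
    then show ?thesis unfolding disjoint_family_on_def by (metis Int_commute linorder_neqE_nat)
  qed
  have E_union: "(\<Union>i<n. B \<inter> E i) = B" for B using E_cover by blast
  define \<mu> where "\<mu> B = (\<Sum>i<n. chart_volume (cs i) (B \<inter> E i))" for B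
  define M where "M = measure_of UNIV (sets borel) \<mu>"
  have sets_M: "sets M = sets borel"
    unfolding M_def using sets.sigma_sets_eq[of borel] by (simp add: sets_measure_of)
  have M: "emeasure M B = \<mu> B" if "B \<in> sets borel" for B
    unfolding M_def
  proof (rule emeasure_measure_of_sigma[OF _ _ _ that])
    show "sigma_algebra UNIV (sets (borel :: 'm measure))"
      using sets.sigma_algebra_axioms[of borel] by simp
    show "positive (sets borel) \<mu>" by (simp add: positive_def \<mu>_def)
    show "countably_additive (sets borel) \<mu>"
    proof (rule countably_additiveI)
      fix B :: "nat \<Rightarrow> 'm set"
      assume B: "range B \<subseteq> sets borel" "disjoint_family B" "(\<Union>i. B i) \<in> sets borel"
      have "(\<Sum>k. \<mu> (B k)) = (\<Sum>i<n. \<Sum>k. chart_volume (cs i) (B k \<inter> E i))"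
        unfolding \<mu>_def by (rule suminf_sum) (rule summableI)
      also have "\<dots> = (\<Sum>i<n. chart_volume (cs i) (\<Union>k. B k \<inter> E i))"
      proof (rule sum.cong[OF refl])
        fix i assume "i \<in> {..<n}"
        then have i: "i < n" by simp
        show "(\<Sum>k. chart_volume (cs i) (B k \<inter> E i)) = chart_volume (cs i) (\<Union>k. B k \<inter> E i)"
          using B(1,2) E[OF i] cs[OF i]
          by (intro chart_volume_UN) (auto simp: disjoint_family_on_def)
      qed
      also have "\<dots> = \<mu> (\<Union>k. B k)"
        by (simp add: \<mu>_def)
      finally show "(\<Sum>k. \<mu> (B k)) = \<mu> (\<Union>k. B k)" .
    qed
  qed
  have split: "emeasure N B = (\<Sum>i<n. emeasure N (B \<inter> E i))"
    if "sets N = sets borel" "B \<in> sets borel" for N :: "'m measure" and B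
  proof -
    have "(\<Sum>i<n. emeasure N (B \<inter> E i)) = emeasure N (\<Union>i<n. B \<inter> E i)"
      using that E E_disj by (intro sum_emeasure) (auto 0 3 simp: disjoint_family_on_def)
    then show ?thesis by (simp only: E_union)
  qed
  show ?thesis
  proof (rule ex1I[of _ M])
    show "is_riemannian_measure M"
      unfolding is_riemannian_measure_def
    proof (intro conjI ballI impI sets_M)
      fix c B assume c: "c \<in> \<A>" and B: "B \<in> sets borel" "B \<subseteq> fst c"
      have "emeasure M B = (\<Sum>i<n. chart_volume c (B \<inter> E i))"
        unfolding M[OF B(1)] \<mu>_def
      proof (rule sum.cong[OF refl])
        fix i assume "i \<in> {..<n}"
        then have i: "i < n" by simp
        show "chart_volume (cs i) (B \<inter> E i) = chart_volume c (B \<inter> E i)"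
          using c B E[OF i] cs[OF i] by (intro chart_volume_change) auto
      qed
      \<comment> \<open>Padding with empty sets turns the finite union into a sequence, to which
        countable additivity applies.\<close>
      also have "\<dots> = (\<Sum>i. chart_volume c (if i < n then B \<inter> E i else {}))"
        by (subst suminf_finite[of "{..<n}"]) (auto intro!: sum.cong)
      also have "\<dots> = chart_volume c (\<Union>i. if i < n then B \<inter> E i else {})"
        using c B E E_disj
        by (intro chart_volume_UN) (auto 0 3 simp: disjoint_family_on_def split: if_splits)
      also have "(\<Union>i. if i < n then B \<inter> E i else {}) = (\<Union>i<n. B \<inter> E i)"
        by (auto split: if_splits)
      finally show "emeasure M B = chart_volume c B" by (simp only: E_union)
    qed
    fix N assume N: "is_riemannian_measure N"
    show "N = M"
    proof (rule measure_eqI)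
      show "sets N = sets M" using N sets_M by (simp add: is_riemannian_measure_def)
      fix B assume "B \<in> sets N"
      then have B: "B \<in> sets borel" using N by (simp add: is_riemannian_measure_def)
      have "emeasure N B = (\<Sum>i<n. emeasure N (B \<inter> E i))"
        using N B by (intro split) (auto simp: is_riemannian_measure_def)
      also have "\<dots> = \<mu> B"
        unfolding \<mu>_def
      proof (rule sum.cong[OF refl])
        fix i assume "i \<in> {..<n}"
        then have i: "i < n" by simp
        show "emeasure N (B \<inter> E i) = chart_volume (cs i) (B \<inter> E i)"
          using N cs[OF i] sets.Int[OF B E(1)[OF i]] le_infI2[OF E(2)[OF i], of B]
          unfolding is_riemannian_measure_def by blast
      qed
      finally show "emeasure N B = emeasure M B" using M[OF B] by simp
    qed
  qed
qed

abbreviation vol :: "'m measure" where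
  "vol \<equiv> riemannian_measure \<A> g"

lemma is_riemannian_measure_vol: "is_riemannian_measure vol"
proof -
  have "vol = (THE \<mu>. is_riemannian_measure \<mu>)"
    by (simp add: riemannian_measure_def is_riemannian_measure_def chart_volume_def
        ennreal_chart_density)
  then show ?thesis using theI'[OF riemannian_measure_exists_unique] by simp
qed

lemma sets_vol [measurable_cong, simp]: "sets vol = sets borel"
  using is_riemannian_measure_vol by (simp add: is_riemannian_measure_def)

lemma space_vol [simp]: "space vol = UNIV"
  using sets_eq_imp_space_eq[OF sets_vol] by simp

lemma emeasure_vol_chart:
  "c \<in> \<A> \<Longrightarrow> B \<in> sets borel \<Longrightarrow> B \<subseteq> fst c \<Longrightarrow> emeasure vol B = chart_volume c B"
  using is_riemannian_measure_vol by (simp add: is_riemannian_measure_def)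

lemma chart_ball:
  assumes "c \<in> \<A>" "p \<in> fst c"
  obtains r where "0 < r" "cball (snd c p) r \<subseteq> snd c ` fst c"
  using open_chart_range[OF assms(1)] assms(2) by (meson imageI open_contains_cball)

lemma open_chart_preimage:
  assumes "c \<in> \<A>" "open S"
  shows "open (fst c \<inter> snd c -` S)"
  using continuous_open_preimage[OF continuous_on_chart open_chart] assms by blast

text \<open>The density is continuous, hence bounded on a compact coordinate ball.\<close>

lemma vol_locally_finite: "\<exists>U. open U \<and> p \<in> U \<and> emeasure vol U < \<infinity>"
proof -
  obtain c where c: "c \<in> \<A>" "p \<in> fst c" using chart_cover by blast
  then obtain r where r: "0 < r" "cball (snd c p) r \<subseteq> snd c ` fst c" using chart_ball by blast
  let ?U = "fst c \<inter> snd c -` ball (snd c p) r"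
  have "open ?U" using c by (intro open_chart_preimage) auto
  have "continuous_on (cball (snd c p) r) (chart_density c)"
    using continuous_on_chart_density[OF c(1)] r(2) by (rule continuous_on_subset)
  then have "bounded (chart_density c ` cball (snd c p) r)"
    by (intro compact_imp_bounded compact_continuous_image compact_cball)
  then obtain K where K: "\<And>y. y \<in> cball (snd c p) r \<Longrightarrow> chart_density c y \<le> K"
    unfolding bounded_iff by (metis abs_le_D1 image_eqI real_norm_def)
  have "emeasure vol ?U = chart_volume c ?U"
    using c \<open>open ?U\<close> by (intro emeasure_vol_chart) auto
  also have "\<dots> \<le> (\<integral>\<^sup>+ y. ennreal K * indicator (ball (snd c p) r) y \<partial>lborel)"
    unfolding chart_volume_def using K
    by (intro nn_integral_mono) (auto simp: indicator_def intro!: ennreal_leI)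
  also have "\<dots> = ennreal K * emeasure lborel (ball (snd c p) r)"
    by (simp add: nn_integral_cmult_indicator)
  also have "\<dots> < \<infinity>"
    using emeasure_bounded_finite[OF bounded_ball[of "snd c p" r]]
    by (simp add: ennreal_mult_less_top)
  finally show ?thesis using \<open>open ?U\<close> c r(1) by (intro exI[of _ ?U]) auto
qed

text \<open>Finiteness enters three times: it gives sigma-finiteness for Tonelli, it permits the
  cancellation in the difference of volumes, and it makes an error of \<open>\<epsilon>\<close>
  times the total volume vanish.\<close>

lemma finite_measure_vol: "finite_measure vol"
proof (rule finite_measureI)
  from vol_locally_finite obtain U
    where U: "\<And>p. open (U p)" "\<And>p. p \<in> U p" "\<And>p. emeasure vol (U p) < \<infinity>"
    by metis
  then obtain P where P: "finite P" "UNIV \<subseteq> (\<Union>p\<in>P. U p)"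
    using compactE_image[OF compact_UNIV, of UNIV U] by (metis UNIV_I UN_I subsetI)
  have "emeasure vol (space vol) \<le> emeasure vol (\<Union>p\<in>P. U p)"
    using P U(1) by (intro emeasure_mono) auto
  also have "\<dots> \<le> (\<Sum>p\<in>P. emeasure vol (U p))"
    using P(1) U(1) by (intro emeasure_subadditive_finite) auto
  also have "\<dots> < \<infinity>"
    using P(1) U(3) by (simp add: less_top)
  finally show "emeasure vol (space vol) \<noteq> \<infinity>" by simp
qed

end

section \<open>Covector fields and curves\<close>

context compact_riemannian
begin

definition covector_field :: "('m, 'n) one_form \<Rightarrow> bool" where
  "covector_field W \<longleftrightarrow>
     (\<forall>c\<in>\<A>. continuous_on (snd c ` fst c) (\<lambda>y. W c (chart_inv c y))) \<and>
     (\<forall>c\<in>\<A>. \<forall>d\<in>\<A>. \<forall>p\<in>fst c \<inter> fst d. W c p = transpose (jac c d p) *v W d p)"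

definition conorm :: "('m, 'n) one_form \<Rightarrow> 'm \<Rightarrow> real" where
  "conorm W p = sqrt (cosq (g (chart_at \<A> p) p) (W (chart_at \<A> p) p))"

definition has_differential :: "('m \<Rightarrow> real) \<Rightarrow> ('m, 'n) one_form \<Rightarrow> bool" where
  "has_differential F W \<longleftrightarrow> covector_field W \<and>
     (\<forall>c\<in>\<A>. \<forall>y\<in>snd c ` fst c.
        ((\<lambda>y. F (chart_inv c y)) has_derivative (\<lambda>v. W c (chart_inv c y) \<bullet> v)) (at y))"

lemma covector_field_continuous:
  "covector_field W \<Longrightarrow> c \<in> \<A> \<Longrightarrow> continuous_on (snd c ` fst c) (\<lambda>y. W c (chart_inv c y))"
  by (simp add: covector_field_def)

text \<open>Independence of the chart, through \<open>cosq_transform\<close>. Only in a fixed chart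
  is the norm seen to be continuous.\<close>

lemma conorm_chart:
  assumes W: "covector_field W" and c: "c \<in> \<A>" "p \<in> fst c"
  shows "conorm W p = sqrt (cosq (g c p) (W c p))"
proof -
  let ?d = "chart_at \<A> p"
  have d: "?d \<in> \<A>" "p \<in> fst ?d" by (rule chart_at_in in_chart_at)+
  have "W c p = transpose (jac c ?d p) *v W ?d p"
    using W c d unfolding covector_field_def by blast
  moreover have "g c p = transpose (jac c ?d p) ** g ?d p ** jac c ?d p"
    using metric_transform c d by blast
  ultimately have "cosq (g c p) (W c p) = cosq (g ?d p) (W ?d p)"
    using pos_def_metric c d cosq_transform by metis
  then show ?thesis by (simp add: conorm_def)
qed

lemma conorm_nonneg [simp]: "0 \<le> conorm W p"
  using cosq_nonneg[OF pos_def_metric[OF chart_at_in in_chart_at]] by (simp add: conorm_def)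

lemma continuous_on_charts:
  assumes "\<And>c. c \<in> \<A> \<Longrightarrow> continuous_on (fst c) h"
  shows "continuous_on UNIV h"
proof -
  have "continuous_on (\<Union>c\<in>\<A>. fst c) h"
    using assms open_chart by (intro continuous_on_open_UN) auto
  then show ?thesis using atlas by (simp add: smooth_atlas_def)
qed

lemma continuous_on_conorm_chart:
  assumes W: "covector_field W" and c: "c \<in> \<A>"
  shows "continuous_on (snd c ` fst c) (\<lambda>y. conorm W (chart_inv c y))"
proof -
  have "continuous_on (snd c ` fst c) (\<lambda>y. sqrt (cosq (g c (chart_inv c y)) (W c (chart_inv c y))))"
    using W c pos_def_metric[OF c] chart_inv_in[OF c]
    by (intro continuous_intros continuous_on_cosq continuous_on_metric covector_field_continuous) auto
  moreover have "conorm W (chart_inv c y) = sqrt (cosq (g c (chart_inv c y)) (W c (chart_inv c y)))"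
    if "y \<in> snd c ` fst c" for y
    using conorm_chart[OF W c chart_inv_in[OF c that]] .
  ultimately show ?thesis by (simp cong: continuous_on_cong)
qed

lemma continuous_on_conorm:
  assumes "covector_field W"
  shows "continuous_on UNIV (conorm W)"
  using continuous_on_conorm_chart[OF assms]
  by (intro continuous_on_charts continuous_on_chart_pullback)

section \<open>Growth of functions along curves of bounded length\<close>

lemma curve_speed_chart:
  assumes c: "c \<in> \<A>" and s: "s \<in> {0<..<T}" and \<gamma>: "\<gamma> ` {0..T} \<subseteq> fst c"
    and v: "((snd c \<circ> \<gamma>) has_vector_derivative v) (at s)"
  shows "curve_speed \<A> g \<gamma> s = sqrt (v \<bullet> (g c (\<gamma> s) *v v))"
proof -
  let ?p = "\<gamma> s"
  let ?d = "chart_at \<A> ?p"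
  let ?J = "jac c ?d ?p"
  have d: "?d \<in> \<A>" "?p \<in> fst ?d" by (rule chart_at_in in_chart_at)+
  have p: "?p \<in> fst c" using s \<gamma> by auto
  have "((transition c ?d \<circ> (snd c \<circ> \<gamma>)) has_derivative ((\<lambda>v. ?J *v v) \<circ> (\<lambda>h. h *\<^sub>R v))) (at s)"
    using v transition_has_derivative[OF c d(1) p d(2)]
    by (intro diff_chain_at) (simp_all add: has_vector_derivative_def)
  then have "((transition c ?d \<circ> (snd c \<circ> \<gamma>)) has_vector_derivative (?J *v v)) (at s)"
    by (simp add: has_vector_derivative_def o_def matrix_vector_mult_scaleR)
  then have "((snd ?d \<circ> \<gamma>) has_vector_derivative (?J *v v)) (at s)"
    by (rule has_vector_derivative_transform_within_open[of _ _ _ "{0<..<T}"])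
       (use s \<gamma> c in \<open>auto simp: transition_chart image_subset_iff\<close>)
  then have "vector_derivative (snd ?d \<circ> \<gamma>) (at s) = ?J *v v"
    by (rule vector_derivative_at)
  then have "curve_speed \<A> g \<gamma> s = sqrt ((?J *v v) \<bullet> (g ?d ?p *v (?J *v v)))"
    by (simp add: curve_speed_def Let_def)
  also have "(?J *v v) \<bullet> (g ?d ?p *v (?J *v v)) = v \<bullet> (g c ?p *v v)"
    unfolding metric_transform[OF c d(1) p d(2)] inner_commute[of v]
    by (simp add: matrix_vector_mul_assoc[symmetric] dot_lmul_matrix) (rule inner_commute)
  finally show ?thesis .
qed

text \<open>The fundamental theorem of calculus along the curve, with Cauchy-Schwarz under the
  integral. It is applied to a linear function, to confine a short curve to a chart, and then to
  \<open>F\<close> itself. The end time \<open>T\<close> is left free because the confinement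
  argument stops at the first exit.\<close>

lemma curve_increment_le:
  assumes c: "c \<in> \<A>" and \<gamma>: "piecewise_C1_curve \<A> \<gamma>" and T: "0 \<le> T" "T \<le> 1"
    and img: "\<gamma> ` {0..T} \<subseteq> fst c"
    and len: "curve_length \<A> g \<gamma> \<le> ennreal L" "0 \<le> L"
    and \<phi>: "\<And>y. y \<in> snd c ` fst c \<Longrightarrow> (\<phi> has_derivative (\<lambda>v. w y \<bullet> v)) (at y)"
    and K: "\<And>s. s \<in> {0..T} \<Longrightarrow> sqrt (cosq (g c (\<gamma> s)) (w (snd c (\<gamma> s)))) \<le> K" "0 \<le> K"
  shows "\<phi> (snd c (\<gamma> T)) - \<phi> (snd c (\<gamma> 0)) \<le> K * L"
proof -
  let ?x = "snd c \<circ> \<gamma>"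
  have "?x piecewise_C1_differentiable_on {0..T}"
    using \<gamma> c T img unfolding piecewise_C1_curve_def by auto
  then obtain S where cont: "continuous_on {0..T} ?x" and S: "finite S"
    and "?x C1_differentiable_on ({0..T} - S)"
    unfolding piecewise_C1_differentiable_on_def by blast
  then obtain D where D: "\<And>s. s \<in> {0..T} - S \<Longrightarrow> (?x has_vector_derivative D s) (at s)"
    and contD: "continuous_on ({0..T} - S) D"
    unfolding C1_differentiable_on_def by blast
  \<comment> \<open>The end points and the breakpoints, where the velocity is not controlled, are
    removed.\<close>
  define Z where "Z = {0<..<T} - S"
  have Z: "Z \<subseteq> {0..T}" "Z \<subseteq> {0..T} - S" by (auto simp: Z_def)
  have "Z \<in> sets borel" using S by (simp add: Z_def sets.Diff finite_imp_closed borel_closed)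
  \<comment> \<open>The speed, set to 0 off \<open>Z\<close>: measurable and nonnegative everywhere,
    while its integral is still at most the length.\<close>
  define \<sigma> where "\<sigma> s = indicator Z s * sqrt (D s \<bullet> (g c (\<gamma> s) *v D s))" for s
  have \<gamma>c: "\<gamma> s \<in> fst c" if "s \<in> {0..T}" for s using img that by auto
  have \<sigma>0: "0 \<le> \<sigma> s" for s
    using Z pos_def_nonneg[OF pos_def_metric[OF c \<gamma>c]] by (auto simp: \<sigma>_def indicator_def)
  have speed: "curve_speed \<A> g \<gamma> s = \<sigma> s" if "s \<in> Z" for s
    using that Z D by (subst curve_speed_chart[OF c _ img, of s "D s"]) (auto simp: \<sigma>_def Z_def)
  have "continuous_on {0..T} (\<lambda>s. g c (chart_inv c (?x s)))"
    by (rule continuous_on_compose2[OF continuous_on_metric[OF c] cont]) (use \<gamma>c in auto)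
  then have "continuous_on {0..T} (\<lambda>s. g c (\<gamma> s))"
    by (rule continuous_on_eq) (use chart_inv_chart[OF c \<gamma>c] in simp)
  then have "continuous_on Z (\<lambda>s. sqrt (D s \<bullet> (g c (\<gamma> s) *v D s)))"
    using Z contD unfolding matrix_vector_mult_def
    by (intro continuous_intros) (auto intro: continuous_on_subset)
  from borel_measurable_continuous_on_indicator[OF \<open>Z \<in> sets borel\<close> this]
  have \<sigma>_meas: "\<sigma> \<in> borel_measurable borel"
    by (simp add: \<sigma>_def[abs_def])
  have "(\<integral>\<^sup>+ s. ennreal (\<sigma> s) \<partial>lborel) \<le> curve_length \<A> g \<gamma>"
    unfolding curve_length_def
  proof (rule nn_integral_mono)
    fix s
    show "ennreal (\<sigma> s) \<le> ennreal (curve_speed \<A> g \<gamma> s) * indicator {0..1} s"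
      using speed[of s] T by (cases "s \<in> Z") (auto simp: Z_def \<sigma>_def)
  qed
  then have \<sigma>_le: "(\<integral>\<^sup>+ s. ennreal (\<sigma> s) \<partial>lborel) \<le> ennreal L" using len(1) by (rule order_trans)
  then have "(\<integral>\<^sup>+ s. ennreal (\<sigma> s) \<partial>lborel) < \<infinity>" using le_less_trans by fastforce
  then have \<sigma>_int: "integrable lborel \<sigma>"
    using \<sigma>_meas \<sigma>0 by (simp add: integrable_iff_bounded)
  have "ennreal (integral\<^sup>L lborel \<sigma>) \<le> ennreal L"
    using nn_integral_eq_integral[OF \<sigma>_int] \<sigma>0 \<sigma>_le by simp
  then have \<sigma>L: "integral\<^sup>L lborel \<sigma> \<le> L" using len(2) by simp
  have "(\<sigma> has_integral integral\<^sup>L lborel \<sigma>) UNIV"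
    using \<sigma>_int by (rule has_integral_integral_lborel)
  moreover have "\<sigma> = (\<lambda>s. if s \<in> {0..T} then \<sigma> s else 0)"
    using Z by (auto simp: \<sigma>_def indicator_def fun_eq_iff)
  ultimately have "(\<sigma> has_integral integral\<^sup>L lborel \<sigma>) {0..T}"
    using has_integral_restrict_UNIV by metis
  then have K\<sigma>: "((\<lambda>s. K * \<sigma> s) has_integral K * integral\<^sup>L lborel \<sigma>) {0..T}"
    by (rule has_integral_mult_right)
  define \<psi> where "\<psi> s = (if s \<in> Z then w (?x s) \<bullet> D s else 0)" for s
  have \<psi>: "(\<psi> has_integral (\<phi> (?x T) - \<phi> (?x 0))) {0..T}"
  proof -
    have "(\<psi> has_integral ((\<lambda>s. \<phi> (?x s)) T - (\<lambda>s. \<phi> (?x s)) 0)) {0..T}"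
    \<comment> \<open>This version tolerates the finite set of breakpoints, given continuity on the
      closed interval.\<close>
    proof (rule fundamental_theorem_of_calculus_interior_strong[OF S T(1)])
      fix s assume s: "s \<in> {0<..<T} - S"
      have "((\<phi> \<circ> ?x) has_derivative ((\<lambda>v. w (?x s) \<bullet> v) \<circ> (\<lambda>h. h *\<^sub>R D s))) (at s)"
        using D[of s] s \<phi>[of "?x s"] \<gamma>c
        by (intro diff_chain_at) (auto simp: has_vector_derivative_def)
      then show "((\<lambda>s. \<phi> (?x s)) has_vector_derivative \<psi> s) (at s)"
        using s by (simp add: has_vector_derivative_def o_def \<psi>_def Z_def)
    next
      have "continuous_on (snd c ` fst c) \<phi>"
        using has_derivative_continuous[OF \<phi>] by (intro continuous_at_imp_continuous_on ballI)
      then show "continuous_on {0..T} (\<lambda>s. \<phi> (?x s))"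
        by (rule continuous_on_compose2[OF _ cont]) (use \<gamma>c in auto)
    qed
    then show ?thesis by simp
  qed
  have "\<psi> s \<le> K * \<sigma> s" for s
  proof (cases "s \<in> Z")
    case True
    then have s: "s \<in> {0..T}" using Z by blast
    have "w (?x s) \<bullet> D s \<le> sqrt (cosq (g c (\<gamma> s)) (w (?x s))) * sqrt (D s \<bullet> (g c (\<gamma> s) *v D s))"
      using pos_def_metric[OF c \<gamma>c[OF s]] by (rule cosq_Cauchy_Schwarz)
    also have "\<dots> \<le> K * sqrt (D s \<bullet> (g c (\<gamma> s) *v D s))"
      using K(1)[OF s] pos_def_nonneg[OF pos_def_metric[OF c \<gamma>c[OF s]]]
      by (intro mult_right_mono) auto
    finally show ?thesis using True by (simp add: \<psi>_def \<sigma>_def)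
  qed (simp add: \<psi>_def \<sigma>_def)
  then have "\<phi> (?x T) - \<phi> (?x 0) \<le> K * integral\<^sup>L lborel \<sigma>"
    using has_integral_le[OF \<psi> K\<sigma>] by blast
  also have "\<dots> \<le> K * L" using \<sigma>L K(2) by (rule mult_left_mono)
  finally show ?thesis by simp
qed

text \<open>A sufficiently short curve starting near \<open>p0\<close> cannot leave a small
  coordinate ball, and on that ball the norm of \<open>W\<close> varies by at most
  \<open>\<epsilon>\<close>. The bound uses the norm at \<open>p\<close>, the variable of the later
  integration, and puts no restriction on \<open>q\<close>.\<close>

lemma differential_bound_near_local:
  assumes F: "has_differential F W" and \<epsilon>: "0 < \<epsilon>"
  shows "\<exists>U r0. open U \<and> p0 \<in> U \<and> 0 < r0 \<and>
    (\<forall>p\<in>U. \<forall>q r. r < r0 \<longrightarrow> riemannian_dist \<A> g p q < ennreal r \<longrightarrow>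
       F q \<le> F p + r * (conorm W p + \<epsilon>))"
proof -
  have W: "covector_field W" using F by (simp add: has_differential_def)
  obtain c where c: "c \<in> \<A>" "p0 \<in> fst c" using chart_cover by blast
  define x0 where "x0 = snd c p0"
  have "x0 \<in> snd c ` fst c" using c by (simp add: x0_def)
  obtain r1 where r1: "0 < r1" "cball x0 r1 \<subseteq> snd c ` fst c"
    using chart_ball[OF c] unfolding x0_def by blast
  let ?N = "\<lambda>y. conorm W (chart_inv c y)"
  have "isCont ?N x0"
    using continuous_on_conorm_chart[OF W c(1)] open_chart_range[OF c(1)] \<open>x0 \<in> snd c ` fst c\<close>
    by (metis continuous_on_eq_continuous_at)
  then obtain r2 where r2: "0 < r2" "\<And>y. dist y x0 < r2 \<Longrightarrow> dist (?N y) (?N x0) < \<epsilon> / 2"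
    using \<epsilon> unfolding continuous_at_eps_delta by (metis half_gt_zero)
  \<comment> \<open>The ball of radius \<open>2 * \<rho>\<close> has to fit into the chart range and
    into the ball of small oscillation; a curve that starts within \<open>\<rho>\<close> of the
    centre must move by more than \<open>\<rho>\<close> to leave it.\<close>
  define \<rho> where "\<rho> = min r1 r2 / 4"
  have \<rho>: "0 < \<rho>" "2 * \<rho> \<le> r1" "2 * \<rho> < r2" using r1 r2 by (auto simp: \<rho>_def)
  let ?B = "cball x0 (2 * \<rho>)"
  have B: "?B \<subseteq> snd c ` fst c" using r1(2) \<rho>(2) by (meson subset_cball subset_trans)
  have osc: "?N y \<le> ?N z + \<epsilon>" if "y \<in> ?B" "z \<in> ?B" for y z
    using r2(2)[of y] r2(2)[of z] that \<rho> by (auto simp: dist_commute dist_real_def abs_if split: if_splits)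
  \<comment> \<open>Compactness of the ball times the unit sphere bounds the dual norm of all
    Euclidean unit covectors, which compares Euclidean with Riemannian length.\<close>
  have "continuous_on (?B \<times> sphere 0 1) (\<lambda>(y, e). cosq (g c (chart_inv c y)) e)"
    unfolding case_prod_unfold
  proof (rule continuous_on_cosq)
    show "continuous_on (?B \<times> sphere 0 1) (\<lambda>z. g c (chart_inv c (fst z)))"
      by (rule continuous_on_compose2[OF continuous_on_metric[OF c(1)] continuous_on_fst[OF continuous_on_id]])
         (use B in auto)
    show "pos_def (g c (chart_inv c (fst z)))" if "z \<in> ?B \<times> sphere 0 1" for z
      using that B chart_inv_in[OF c(1)] by (intro pos_def_metric[OF c(1)]) auto
  qed (intro continuous_intros)
  then have "bounded ((\<lambda>(y, e). cosq (g c (chart_inv c y)) e) ` (?B \<times> sphere 0 1))"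
    by (intro compact_imp_bounded compact_continuous_image compact_Times compact_cball compact_sphere)
  then obtain K where K: "0 < K" "\<forall>x\<in>(\<lambda>(y, e). cosq (g c (chart_inv c y)) e) ` (?B \<times> sphere 0 1). norm x \<le> K"
    unfolding bounded_pos by blast
  define K0 where "K0 = sqrt K"
  have K0: "0 < K0" using K by (simp add: K0_def)
  have unit: "sqrt (cosq (g c (chart_inv c y)) e) \<le> K0" if "y \<in> ?B" "norm e = 1" for y e
  proof -
    have "cosq (g c (chart_inv c y)) e \<in> (\<lambda>(y, e). cosq (g c (chart_inv c y)) e) ` (?B \<times> sphere 0 1)"
      using that by (intro image_eqI[of _ _ "(y, e)"]) auto
    then have "norm (cosq (g c (chart_inv c y)) e) \<le> K" using K(2) by blast
    then show ?thesis unfolding K0_def by (intro real_sqrt_le_mono) simp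
  qed
  define U where "U = fst c \<inter> snd c -` ball x0 \<rho>"
  define V where "V = fst c \<inter> snd c -` ball x0 (2 * \<rho>)"
  have UV: "open U" "open V" "U \<subseteq> V"
    using open_chart_preimage[OF c(1)] \<rho>(1) by (auto simp: U_def V_def)
  have V_img: "V \<subseteq> chart_inv c ` ?B"
  proof
    fix p assume "p \<in> V"
    then show "p \<in> chart_inv c ` ?B"
      using chart_inv_chart[OF c(1), of p] by (intro image_eqI[of _ _ "snd c p"]) (auto simp: V_def)
  qed
  have img_closed: "closed (chart_inv c ` ?B)"
    using continuous_on_subset[OF continuous_on_chart_inv[OF c(1)] B]
    by (intro compact_imp_closed compact_continuous_image compact_cball)
  have "F q \<le> F p + r * (conorm W p + \<epsilon>)"
    if p: "p \<in> U" and r: "r < \<rho> / K0" and dist: "riemannian_dist \<A> g p q < ennreal r" for p q r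
  proof -
    obtain \<gamma> where \<gamma>: "piecewise_C1_curve \<A> \<gamma>" "\<gamma> 0 = p" "\<gamma> 1 = q" "curve_length \<A> g \<gamma> < ennreal r"
      using dist unfolding riemannian_dist_def by (auto simp: INF_less_iff pathstart_def pathfinish_def)
    \<comment> \<open>For \<open>r\<close> at most 0, \<open>ennreal r\<close> is 0 and no length
      lies below it.\<close>
    have r0: "0 < r" using \<gamma>(4) by (metis ennreal_eq_0_iff not_less not_less_zero)
    have cont: "continuous_on {0..1} \<gamma>" using \<gamma>(1) by (simp add: piecewise_C1_curve_def path_def)
    have pV: "p \<in> V" using p UV by auto
    have stay: "\<gamma> s \<in> V" if s: "s \<in> {0..1}" for s
    proof (rule ccontr)
      assume "\<gamma> s \<notin> V"
      define Z where "Z = {0..1} \<inter> \<gamma> -` (- V)"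
      have "closed Z" unfolding Z_def using UV(2) cont by (intro continuous_closed_preimage) auto
      have "Z \<noteq> {}" using s \<open>\<gamma> s \<notin> V\<close> by (auto simp: Z_def)
      have bdd: "bdd_below Z" by (rule bdd_belowI[of _ 0]) (auto simp: Z_def)
      \<comment> \<open>The first exit time from \<open>V\<close>; it is attained since
        \<open>V\<close> is open and so \<open>Z\<close> is closed.\<close>
      define T where "T = Inf Z"
      have TZ: "T \<in> Z" unfolding T_def by (rule closed_contains_Inf) fact+
      have before: "\<gamma> t \<in> V" if "t \<in> {0..<T}" for t
      proof (rule ccontr)
        assume "\<gamma> t \<notin> V"
        then have "t \<in> Z" using that TZ by (auto simp: Z_def)
        then have "T \<le> t" unfolding T_def using bdd by (rule cInf_lower)
        then show False using that by simp
      qed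
      have T: "0 < T" "T \<le> 1" "\<gamma> T \<notin> V"
        using TZ pV \<gamma>(2) by (auto simp: Z_def less_le)
      \<comment> \<open>The end point lies outside \<open>V\<close>, but by compactness of the
        coordinate ball it still lies in the chart domain, so its coordinates are
        meaningful.\<close>
      have "\<gamma> ` closure {0..<T} \<subseteq> chart_inv c ` ?B"
      proof (rule image_closure_subset[OF _ img_closed])
        show "continuous_on (closure {0..<T}) \<gamma>"
          using cont T by (simp add: closure_atLeastLessThan) (rule continuous_on_subset, auto)
      qed (use before V_img in auto)
      then have imgT: "\<gamma> ` {0..T} \<subseteq> chart_inv c ` ?B" using T by (simp add: closure_atLeastLessThan)
      moreover have "chart_inv c ` ?B \<subseteq> fst c"
        by (intro image_subsetI chart_inv_in[OF c(1)]) (rule subsetD[OF B])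
      ultimately have imgc: "\<gamma> ` {0..T} \<subseteq> fst c" by (rule order_trans)
      have xB: "snd c (\<gamma> t) \<in> ?B" if "t \<in> {0..T}" for t
      proof -
        have "\<gamma> t \<in> chart_inv c ` ?B" using imgT that by (rule subsetD[OF _ imageI])
        then obtain y where "y \<in> ?B" "\<gamma> t = chart_inv c y" by (rule imageE)
        then show ?thesis using chart_chart_inv[OF c(1) subsetD[OF B \<open>y \<in> ?B\<close>]] by simp
      qed
      let ?z = "snd c (\<gamma> T) - snd c (\<gamma> 0)"
      have "\<gamma> T \<in> fst c" using imgc T by auto
      then have "2 * \<rho> \<le> dist x0 (snd c (\<gamma> T))" using T(3) by (simp add: V_def)
      moreover have "dist x0 (snd c (\<gamma> 0)) < \<rho>" using p \<gamma>(2) by (simp add: U_def)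
      ultimately have far: "\<rho> < norm ?z"
        using dist_triangle[of x0 "snd c (\<gamma> T)" "snd c (\<gamma> 0)"] by (simp add: dist_norm norm_minus_commute)
      then have z: "?z \<noteq> 0" using \<rho>(1) by auto
      \<comment> \<open>The linear function in the direction of the displacement has the Euclidean
        distance travelled as its increment.\<close>
      have "(\<lambda>y. sgn ?z \<bullet> y) (snd c (\<gamma> T)) - (\<lambda>y. sgn ?z \<bullet> y) (snd c (\<gamma> 0)) \<le> K0 * r"
      proof (rule curve_increment_le[OF c(1) \<gamma>(1), where w = "\<lambda>_. sgn ?z"])
        show "sqrt (cosq (g c (\<gamma> t)) (sgn ?z)) \<le> K0" if "t \<in> {0..T}" for t
          using unit[OF xB[OF that], of "sgn ?z"] z
            chart_inv_chart[OF c(1) subsetD[OF imgc imageI[OF that]]]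
          by (simp add: norm_sgn)
        show "((\<bullet>) (sgn ?z) has_derivative (\<bullet>) (sgn ?z)) (at y)" for y
          by (rule bounded_linear_imp_has_derivative) (rule bounded_linear_inner_right)
      qed (use T imgc \<gamma>(4) r0 K0 in auto)
      also have "K0 * r < \<rho>" using r K0 by (simp add: field_simps)
      finally have "sgn ?z \<bullet> ?z < \<rho>" by (simp only: inner_diff_right)
      moreover have "sgn ?z \<bullet> ?z = norm ?z"
        unfolding sgn_div_norm inner_scaleR_left dot_square_norm using z by (simp add: power2_eq_square)
      ultimately show False using far by simp
    qed
    have "(\<lambda>y. F (chart_inv c y)) (snd c (\<gamma> 1)) - (\<lambda>y. F (chart_inv c y)) (snd c (\<gamma> 0))
        \<le> (conorm W p + \<epsilon>) * r"
    proof (rule curve_increment_le[OF c(1) \<gamma>(1), where w = "\<lambda>y. W c (chart_inv c y)"])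
      show "\<gamma> ` {0..1} \<subseteq> fst c" using stay by (auto simp: V_def)
      show "((\<lambda>y. F (chart_inv c y)) has_derivative (\<bullet>) (W c (chart_inv c y))) (at y)"
        if "y \<in> snd c ` fst c" for y
        using F c(1) that unfolding has_differential_def by blast
      show "sqrt (cosq (g c (\<gamma> s)) (W c (chart_inv c (snd c (\<gamma> s))))) \<le> conorm W p + \<epsilon>"
        if "s \<in> {0..1}" for s
      proof -
        have \<gamma>s: "\<gamma> s \<in> fst c" "snd c (\<gamma> s) \<in> ?B" and p': "p \<in> fst c" "snd c p \<in> ?B"
          using stay[OF that] pV by (auto simp: V_def)
        show ?thesis
          using osc[OF \<gamma>s(2) p'(2)] conorm_chart[OF W c(1) \<gamma>s(1)]
          by (simp add: chart_inv_chart[OF c(1)] \<gamma>s(1) p'(1))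
      qed
    qed (use \<gamma>(4) r0 \<epsilon> in \<open>auto intro: add_nonneg_nonneg\<close>)
    moreover have "chart_inv c (snd c p) = p" "chart_inv c (snd c q) = q"
      using chart_inv_chart[OF c(1)] pV stay[of 1] \<gamma>(3) by (auto simp: V_def)
    ultimately show ?thesis using \<gamma>(2,3) by (simp add: algebra_simps)
  qed
  moreover have "p0 \<in> U" using c \<rho>(1) by (simp add: U_def x0_def)
  moreover have "0 < \<rho> / K0" using \<rho>(1) K0 by simp
  ultimately show ?thesis using UV(1) by blast
qed

text \<open>The local estimate restricts only the starting point, so the smallest radius of a finite
  subcover serves all pairs.\<close>

lemma differential_bound_near:
  assumes F: "has_differential F W" and \<epsilon>: "0 < \<epsilon>"
  obtains r0 where "0 < r0"
    "\<And>p q r. r < r0 \<Longrightarrow> riemannian_dist \<A> g p q < ennreal r \<Longrightarrow> F q \<le> F p + r * (conorm W p + \<epsilon>)"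
proof -
  obtain U :: "'m \<Rightarrow> 'm set" and R where U: "\<And>p. open (U p)" "\<And>p. p \<in> U p" "\<And>p. 0 < R p"
    and est: "\<And>p0 p q r. p \<in> U p0 \<Longrightarrow> r < R p0 \<Longrightarrow> riemannian_dist \<A> g p q < ennreal r \<Longrightarrow>
      F q \<le> F p + r * (conorm W p + \<epsilon>)"
    using differential_bound_near_local[OF F \<epsilon>] by metis
  obtain P where P: "finite P" "UNIV \<subseteq> (\<Union>p\<in>P. U p)"
    using compactE_image[OF compact_UNIV, of UNIV U] U by (metis UNIV_I UN_I subsetI)
  then have "P \<noteq> {}" by auto
  show ?thesis
  proof (rule that[of "Min (R ` P)"])
    show "0 < Min (R ` P)" using P(1) \<open>P \<noteq> {}\<close> U(3) by simp
    fix p q r assume r: "r < Min (R ` P)" "riemannian_dist \<A> g p q < ennreal r"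
    obtain p0 where "p0 \<in> P" "p \<in> U p0" using P(2) by blast
    moreover have "r < R p0"
      using r(1) P(1) \<open>p0 \<in> P\<close> by (meson Min_le finite_imageI imageI less_le_trans)
    ultimately show "F q \<le> F p + r * (conorm W p + \<epsilon>)"
      using r(2) by (intro est)
  qed
qed

end

section \<open>Integration over layers\<close>

text \<open>For fixed \<open>p\<close> the set of admissible \<open>t\<close> is an interval of
  length \<open>G p - F p\<close>, empty if this is negative. The layers from 0 to the squared
  modulus serve the frustration index, thin layers above the squared modulus the boundary
  area.\<close>

lemma
  fixes F G :: "'a \<Rightarrow> real" and h :: "'a \<Rightarrow> ennreal"
  assumes "sigma_finite_measure M"
    and [measurable]: "F \<in> borel_measurable M" "G \<in> borel_measurable M" "h \<in> borel_measurable M"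
    and nonneg: "\<And>p. 0 \<le> F p"
  shows borel_measurable_layer:
      "(\<lambda>t. \<integral>\<^sup>+p. h p * indicator {F p<..G p} t \<partial>M) \<in> borel_measurable lborel"
    and nn_integral_layer:
      "(\<integral>\<^sup>+t\<in>{0..}. (\<integral>\<^sup>+p. h p * indicator {F p<..G p} t \<partial>M) \<partial>lborel) =
       (\<integral>\<^sup>+p. h p * ennreal (G p - F p) \<partial>M)"
proof -
  interpret M: sigma_finite_measure M by fact
  interpret pair_sigma_finite lborel M by standard
  have ind: "h p * indicator {F p<..G p} t = (if F p < t \<and> t \<le> G p then h p else 0)" for p t
    by (auto simp: indicator_def)
  have [measurable]: "(\<lambda>(t, p). h p * indicator {F p<..G p} t) \<in> borel_measurable (lborel \<Otimes>\<^sub>M M)"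
    unfolding ind by measurable
  show "(\<lambda>t. \<integral>\<^sup>+p. h p * indicator {F p<..G p} t \<partial>M) \<in> borel_measurable lborel"
    by measurable
  have "(\<integral>\<^sup>+t\<in>{0..}. (\<integral>\<^sup>+p. h p * indicator {F p<..G p} t \<partial>M) \<partial>lborel) =
      (\<integral>\<^sup>+t. (\<integral>\<^sup>+p. h p * indicator {F p<..G p} t \<partial>M) \<partial>lborel)"
  proof (rule nn_integral_cong)
    fix t :: real
    \<comment> \<open>Since \<open>F\<close> is nonnegative, no interval meets the negative
      half-line and the restriction to \<open>{0..}\<close> loses nothing.\<close>
    have "(\<integral>\<^sup>+p. h p * indicator {F p<..G p} t \<partial>M) = (\<integral>\<^sup>+p. 0 \<partial>M)" if "t < 0"
    proof (rule nn_integral_cong)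
      show "h p * indicator {F p<..G p} t = 0" for p
        using nonneg[of p] that by (simp add: indicator_def)
    qed
    then show "(\<integral>\<^sup>+p. h p * indicator {F p<..G p} t \<partial>M) * indicator {0..} t =
        (\<integral>\<^sup>+p. h p * indicator {F p<..G p} t \<partial>M)"
      by (cases "t < 0") auto
  qed
  also have "\<dots> = (\<integral>\<^sup>+p. (\<integral>\<^sup>+t. h p * indicator {F p<..G p} t \<partial>lborel) \<partial>M)"
    by (rule Fubini'[symmetric]) measurable
  also have "\<dots> = (\<integral>\<^sup>+p. h p * ennreal (G p - F p) \<partial>M)"
  proof (rule nn_integral_cong)
    fix p
    have "emeasure lborel {F p<..G p} = ennreal (G p - F p)"
      by (cases "F p \<le> G p") (auto simp: ennreal_neg)
    then show "(\<integral>\<^sup>+t. h p * indicator {F p<..G p} t \<partial>lborel) = h p * ennreal (G p - F p)"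
      by (simp add: nn_integral_cmult_indicator)
  qed
  finally show "(\<integral>\<^sup>+t\<in>{0..}. (\<integral>\<^sup>+p. h p * indicator {F p<..G p} t \<partial>M) \<partial>lborel) =
       (\<integral>\<^sup>+p. h p * ennreal (G p - F p) \<partial>M)" .
qed

text \<open>Each \<open>p\<close> lies on a single level, so Tonelli allows the two quantifiers to
  be exchanged.\<close>

lemma AE_level_null:
  fixes F :: "'a \<Rightarrow> real"
  assumes "sigma_finite_measure M" and [measurable]: "F \<in> borel_measurable M"
  shows "AE t in lborel. AE p in M. F p \<noteq> t"
proof -
  interpret M: sigma_finite_measure M by fact
  interpret pair_sigma_finite lborel M by standard
  have "AE p in M. AE t in lborel. F p \<noteq> t"
  proof (rule AE_I2)
    show "AE t in lborel. F p \<noteq> t" for p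
      using AE_lborel_singleton[of "F p"] by eventually_elim auto
  qed
  moreover have "{x \<in> space (lborel \<Otimes>\<^sub>M M). F (snd x) \<noteq> fst x} \<in> sets (lborel \<Otimes>\<^sub>M M)"
    by measurable
  ultimately show ?thesis
    using AE_commute[of "\<lambda>t p. F p \<noteq> t"] by simp
qed

text \<open>Passes from the continuous parameter to a sequence, as Fatou's lemma requires.\<close>

lemma Liminf_at_right_0_le:
  fixes \<phi> :: "real \<Rightarrow> 'a::complete_linorder"
  assumes "filterlim r (at_right 0) sequentially"
  shows "Liminf (at_right 0) \<phi> \<le> liminf (\<lambda>n. \<phi> (r n))"
proof -
  have "Liminf (at_right 0) \<phi> \<le> Liminf (filtermap r sequentially) \<phi>"
    using assms unfolding Liminf_def filterlim_def by (intro SUP_subset_mono) (auto simp: le_filter_def)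
  also have "\<dots> \<le> liminf (\<lambda>n. \<phi> (r n))"
    by (rule Liminf_filtermap_le)
  finally show ?thesis .
qed

section \<open>The real and imaginary part of the magnetic differential\<close>

text \<open>The real covector \<open>Re (z D)\<close>. The factor \<open>- \<i>\<close> in
  \<open>z\<close> yields imaginary parts, so one construction covers both halves of the magnetic
  differential.\<close>

definition re_components :: "complex \<Rightarrow> (real^'n \<Rightarrow> complex) \<Rightarrow> real^'n" where
  "re_components z D = (\<chi> j. Re (z * D (axis j 1)))"

lemma re_components_inner:
  assumes "linear D"
  shows "re_components z D \<bullet> w = Re (z * D w)"
proof -
  have "D w = D (\<Sum>j\<in>UNIV. w $ j *\<^sub>R axis j 1)"
    by (simp only: basis_expansion scalar_mult_eq_scaleR[symmetric])
  also have "\<dots> = (\<Sum>j\<in>UNIV. w $ j *\<^sub>R D (axis j 1))"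
    using assms by (simp add: linear_sum linear_scale)
  finally have "z * D w = (\<Sum>j\<in>UNIV. w $ j *\<^sub>R (z * D (axis j 1)))"
    by (simp add: sum_distrib_left)
  then show ?thesis by (simp add: re_components_def inner_vec_def mult.commute)
qed

lemma re_components_transform:
  assumes "linear D"
  shows "re_components z (\<lambda>w. D (J *v w)) = transpose J *v re_components z D"
proof (rule vector_eq_ldot[THEN iffD1], rule allI)
  fix w
  have "linear (\<lambda>w. D (J *v w))"
    using linear_compose[OF matrix_vector_mul_linear[of J] assms] by (simp add: o_def)
  then have "re_components z (\<lambda>w. D (J *v w)) \<bullet> w = re_components z D \<bullet> (J *v w)"
    using assms by (simp add: re_components_inner)
  also have "\<dots> = (transpose J *v re_components z D) \<bullet> w"
    by (simp add: dot_lmul_matrix)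
  finally show "w \<bullet> re_components z (\<lambda>w. D (J *v w)) = w \<bullet> (transpose J *v re_components z D)"
    by (simp only: inner_commute)
qed

locale magnetic_riemannian = compact_riemannian \<A> g
  for \<A> :: "('m::{t2_space, second_countable_topology}, 'n::finite) chart set"
    and g :: "('m, 'n) metric" +
  fixes \<alpha> :: "('m, 'n) one_form"
    and f :: "'m \<Rightarrow> complex"
  assumes potential: "smooth_one_form \<A> \<alpha>"
    and smooth_f: "smooth_fun_on \<A> UNIV f"
begin

lemma smooth_f_chart:
  assumes "c \<in> \<A>"
  shows "smooth_on (snd c ` fst c) (f \<circ> chart_inv c)"
  unfolding smooth_on_def
proof (intro allI Ck_on_local)
  fix k y assume "y \<in> snd c ` fst c"
  then obtain p where p: "p \<in> fst c" "y = snd c p" by blast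
  have "\<exists>W h. p \<in> W \<and> smooth_fun_on_open \<A> W h \<and> (\<forall>q\<in>W \<inter> UNIV. h q = f q)"
    using smooth_f unfolding smooth_fun_on_def by (rule bspec) simp
  then obtain W h where W: "p \<in> W" "smooth_fun_on_open \<A> W h" "\<forall>q\<in>W \<inter> UNIV. h q = f q"
    by (elim exE conjE)
  let ?T = "snd c ` (fst c \<inter> W)"
  have T: "open ?T" "y \<in> ?T"
    using W(1,2) p open_chart_image[OF assms] unfolding smooth_fun_on_open_def by blast+
  have "Ck_on k ?T (h \<circ> chart_inv c)"
    using W(2) assms by (simp add: smooth_fun_on_open_def smooth_on_def)
  then have "Ck_on k ?T (f \<circ> chart_inv c)"
    by (rule Ck_on_cong[OF T(1), rotated]) (use W(3) chart_inv_chart[OF assms] in auto)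
  with T show "\<exists>T. open T \<and> y \<in> T \<and> Ck_on k T (f \<circ> chart_inv c)" by blast
qed

lemma continuous_on_f: "continuous_on UNIV f"
proof (intro continuous_on_charts continuous_on_chart_pullback)
  fix c assume "c \<in> \<A>"
  then have "Ck_on 0 (snd c ` fst c) (f \<circ> chart_inv c)"
    using smooth_f_chart unfolding smooth_on_def by blast
  then show "continuous_on (snd c ` fst c) (\<lambda>y. f (chart_inv c y))" by (simp add: o_def)
qed

lemma continuous_on_f_chart:
  assumes "c \<in> \<A>"
  shows "continuous_on (snd c ` fst c) (\<lambda>y. f (chart_inv c y))"
  by (rule continuous_on_compose2[OF continuous_on_f continuous_on_chart_inv[OF assms]]) simp

definition df :: "('m, 'n) chart \<Rightarrow> 'm \<Rightarrow> real^'n \<Rightarrow> complex" where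
  "df c p = frechet_derivative (f \<circ> chart_inv c) (at (snd c p))"

lemma
  assumes c: "c \<in> \<A>"
  shows has_derivative_f_chart: "p \<in> fst c \<Longrightarrow> ((f \<circ> chart_inv c) has_derivative df c p) (at (snd c p))"
    and continuous_on_df: "continuous_on (snd c ` fst c) (\<lambda>y. df c (chart_inv c y) v)"
proof -
  have C1: "Ck_on (Suc 0) (snd c ` fst c) (f \<circ> chart_inv c)"
    using smooth_f_chart[OF c] unfolding smooth_on_def by blast
  then show "((f \<circ> chart_inv c) has_derivative df c p) (at (snd c p))" if "p \<in> fst c"
    using Ck_on_has_derivative[OF C1 imageI[OF that]] by (simp only: df_def)
  have "continuous_on (snd c ` fst c) (\<lambda>y. frechet_derivative (f \<circ> chart_inv c) (at y) v)"
    using C1 by simp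
  then show "continuous_on (snd c ` fst c) (\<lambda>y. df c (chart_inv c y) v)"
    by (rule continuous_on_eq) (simp add: df_def chart_chart_inv[OF c])
qed

lemma linear_df: "c \<in> \<A> \<Longrightarrow> p \<in> fst c \<Longrightarrow> linear (df c p)"
  using has_derivative_f_chart by (rule has_derivative_linear)

lemma df_transform:
  assumes c: "c \<in> \<A>" "p \<in> fst c" and d: "d \<in> \<A>" "p \<in> fst d"
  shows "df c p = (\<lambda>v. df d p (jac c d p *v v))"
proof -
  have "((f \<circ> chart_inv d) \<circ> transition c d has_derivative df d p \<circ> (\<lambda>v. jac c d p *v v)) (at (snd c p))"
    using has_derivative_f_chart[OF d] transition_has_derivative[OF c(1) d(1) c(2) d(2)]
    by (intro diff_chain_at) (simp_all add: transition_chart[OF c])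
  then have "(f \<circ> chart_inv c has_derivative df d p \<circ> (\<lambda>v. jac c d p *v v)) (at (snd c p))"
  proof (rule has_derivative_transform_within_open)
    show "open (snd c ` (fst c \<inter> fst d))" using c(1) open_chart[OF d(1)] by (rule open_chart_image)
    show "snd c p \<in> snd c ` (fst c \<inter> fst d)" using c d by blast
    show "((f \<circ> chart_inv d) \<circ> transition c d) y = (f \<circ> chart_inv c) y" if "y \<in> snd c ` (fst c \<inter> fst d)" for y
      using that by (auto simp: transition_chart[OF c(1)] chart_inv_chart[OF c(1)] chart_inv_chart[OF d(1)])
  qed
  then show ?thesis
    unfolding df_def[of c] by (simp add: frechet_derivative_eq o_def)
qed

lemma covector_field_re_components:
  assumes "continuous_on UNIV z"
  shows "covector_field (\<lambda>c p. re_components (z (f p)) (df c p))"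
  unfolding covector_field_def
proof (intro conjI ballI)
  fix c assume c: "c \<in> \<A>"
  have "continuous_on (snd c ` fst c) (\<lambda>y. z (f (chart_inv c y)))"
    by (rule continuous_on_compose2[OF assms continuous_on_f_chart[OF c]]) simp
  then show "continuous_on (snd c ` fst c) (\<lambda>y. re_components (z (f (chart_inv c y))) (df c (chart_inv c y)))"
    unfolding re_components_def by (intro continuous_intros continuous_on_df c)
next
  fix c d p assume "c \<in> \<A>" "d \<in> \<A>" "p \<in> fst c \<inter> fst d"
  then have c: "c \<in> \<A>" "p \<in> fst c" and d: "d \<in> \<A>" "p \<in> fst d" by auto
  show "re_components (z (f p)) (df c p) = transpose (jac c d p) *v re_components (z (f p)) (df d p)"
    unfolding df_transform[OF c d] by (rule re_components_transform[OF linear_df[OF d]])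
qed

text \<open>With \<open>F = \<bar>f\<bar>\<^sup>2\<close>, one has \<open>cnj f (d + i\<alpha>) f = dF / 2 + i current\<close>.\<close>

definition dF :: "('m, 'n) one_form" where
  "dF c p = re_components (2 * cnj (f p)) (df c p)"

definition current :: "('m, 'n) one_form" where
  "current c p = re_components (- \<i> * cnj (f p)) (df c p) + (cmod (f p))\<^sup>2 *\<^sub>R \<alpha> c p"

lemma has_differential_dF: "has_differential (\<lambda>p. (cmod (f p))\<^sup>2) dF"
  unfolding has_differential_def
proof (intro conjI ballI)
  show "covector_field dF"
    unfolding dF_def[abs_def] by (rule covector_field_re_components) (intro continuous_intros)
  fix c y assume c: "c \<in> \<A>" and "y \<in> snd c ` fst c"
  then obtain p where p: "p \<in> fst c" "y = snd c p" by blast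
  let ?\<phi> = "f \<circ> chart_inv c"
  have y: "chart_inv c y = p" using chart_inv_chart[OF c p(1)] p(2) by simp
  have "(?\<phi> has_derivative df c p) (at y)" using has_derivative_f_chart[OF c p(1)] p(2) by simp
  from has_derivative_inner[OF this this]
  have "((\<lambda>y. (cmod (f (chart_inv c y)))\<^sup>2) has_derivative (\<lambda>v. f p \<bullet> df c p v + df c p v \<bullet> f p)) (at y)"
    by (simp add: power2_norm_eq_inner y)
  also have "(\<lambda>v. f p \<bullet> df c p v + df c p v \<bullet> f p) = (\<lambda>v. dF c p \<bullet> v)"
    using linear_df[OF c p(1)] by (auto simp: dF_def re_components_inner inner_complex_def)
  finally show "((\<lambda>y. (cmod (f (chart_inv c y)))\<^sup>2) has_derivative (\<lambda>v. dF c (chart_inv c y) \<bullet> v)) (at y)"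
    by (simp only: y)
qed

lemma covector_field_dF: "covector_field dF"
  using has_differential_dF by (simp add: has_differential_def)

lemma covector_field_current: "covector_field current"
proof -
  have re: "covector_field (\<lambda>c p. re_components (- \<i> * cnj (f p)) (df c p))"
    by (rule covector_field_re_components) (intro continuous_intros)
  show ?thesis
    unfolding covector_field_def
  proof (intro conjI ballI)
    fix c assume c: "c \<in> \<A>"
    have "Ck_on 0 (snd c ` fst c) (\<alpha> c \<circ> chart_inv c)"
      using potential c unfolding smooth_one_form_def smooth_on_def by blast
    then have "continuous_on (snd c ` fst c) (\<lambda>y. \<alpha> c (chart_inv c y))" by (simp add: o_def)
    then show "continuous_on (snd c ` fst c) (\<lambda>y. current c (chart_inv c y))"
      unfolding current_def
      by (intro continuous_on_add continuous_on_scaleR continuous_on_power continuous_on_norm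
          continuous_on_f_chart c covector_field_continuous[OF re])
  next
    fix c d p assume cd: "c \<in> \<A>" "d \<in> \<A>" "p \<in> fst c \<inter> fst d"
    have "\<alpha> c p = transpose (jac c d p) *v \<alpha> d p"
      using potential cd unfolding smooth_one_form_def by blast
    moreover have "re_components (- \<i> * cnj (f p)) (df c p) =
        transpose (jac c d p) *v re_components (- \<i> * cnj (f p)) (df d p)"
      using re cd unfolding covector_field_def by blast
    ultimately show "current c p = transpose (jac c d p) *v current d p"
      by (simp only: current_def matrix_vector_right_distrib matrix_vector_mult_scaleR)
  qed
qed

lemma borel_measurable_f [measurable]: "f \<in> borel_measurable borel"
  using continuous_on_f by (rule borel_measurable_continuous_onI)

lemma borel_measurable_conorm [measurable]:
  "conorm dF \<in> borel_measurable borel" "conorm current \<in> borel_measurable borel"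
  using continuous_on_conorm covector_field_dF covector_field_current
  by (auto intro: borel_measurable_continuous_onI)

text \<open>Multiplication by \<open>cnj f\<close> scales the norm by the modulus of
  \<open>f\<close> and makes the radial part real and the phase part imaginary.\<close>

lemma magnetic_norm_f:
  "cmod (f p) * magnetic_norm \<A> g \<alpha> UNIV f p = sqrt ((conorm dF p)\<^sup>2 / 4 + (conorm current p)\<^sup>2)"
proof -
  let ?c = "chart_at \<A> p"
  have c: "?c \<in> \<A>" "p \<in> fst ?c" by (rule chart_at_in in_chart_at)+
  let ?\<omega> = "magnetic_diff \<alpha> UNIV f ?c p"
  note pd = pos_def_metric[OF c]
  have "at (snd ?c p) within snd ?c ` (fst ?c \<inter> UNIV) = at (snd ?c p)"
    using open_chart_range[OF c(1)] c(2) by (intro at_within_open) auto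
  then have \<omega>: "?\<omega> $ j = df ?c p (axis j 1) + \<i> * of_real (\<alpha> ?c p $ j) * f p" for j
    by (simp add: magnetic_diff_def df_def)
  have re: "(\<chi> j. Re ((\<chi> j. cnj (f p) * ?\<omega> $ j) $ j)) = (1/2) *\<^sub>R dF ?c p"
    by (simp add: vec_eq_iff \<omega> dF_def re_components_def algebra_simps)
  have im: "(\<chi> j. Im ((\<chi> j. cnj (f p) * ?\<omega> $ j) $ j)) = current ?c p"
    unfolding vec_eq_iff current_def re_components_def
    by (simp add: \<omega> cmod_power2) (simp add: algebra_simps power2_eq_square)
  have "cmod (f p) * magnetic_norm \<A> g \<alpha> UNIV f p =
      covector_norm g ?c p (\<chi> j. cnj (f p) * ?\<omega> $ j)"
    by (simp only: magnetic_norm_def covector_norm_scale complex_mod_cnj)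
  also have "\<dots> = sqrt (cosq (g ?c p) ((1/2) *\<^sub>R dF ?c p) + cosq (g ?c p) (current ?c p))"
    unfolding covector_norm_eq[of g ?c p, OF pd] re im ..
  finally show ?thesis
    using cosq_nonneg[OF pd] by (simp add: cosq_scale power2_eq_square conorm_def)
qed

text \<open>A map of modulus 1 has no radial derivative, so only the current survives: the magnetic
  differential is the current times \<open>\<i> * f p\<close> over the cube of the modulus. The open
  set \<open>W\<close> puts \<open>p\<close> in the interior of \<open>\<Omega>\<close>, where the
  derivative within \<open>\<Omega>\<close> is the ordinary one.\<close>

lemma magnetic_norm_sgn:
  assumes W: "open W" "p \<in> W" "W \<subseteq> \<Omega>" and fp: "f p \<noteq> 0"
  shows "magnetic_norm \<A> g \<alpha> \<Omega> (\<lambda>q. sgn (f q)) p = conorm current p / (cmod (f p))\<^sup>2"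
proof -
  let ?c = "chart_at \<A> p" and ?n = "cmod (f p)" and ?\<tau> = "\<lambda>q. sgn (f q)"
  have c: "?c \<in> \<A>" "p \<in> fst ?c" by (rule chart_at_in in_chart_at)+
  let ?x = "snd ?c p" and ?\<phi> = "f \<circ> chart_inv ?c" and ?D = "df ?c p"
  note pd = pos_def_metric[OF c]
  have n: "0 < ?n" using fp by simp
  have \<phi>x: "?\<phi> ?x = f p" using chart_inv_chart[OF c] by simp
  have "?x \<in> interior (snd ?c ` (fst ?c \<inter> \<Omega>))"
    using W c open_chart_image[OF c(1) W(1)] by (intro interiorI[of "snd ?c ` (fst ?c \<inter> W)"]) auto
  then have at: "at ?x within snd ?c ` (fst ?c \<inter> \<Omega>) = at ?x" by (rule at_within_interior)
  have \<phi>: "(?\<phi> has_derivative ?D) (at ?x)" by (rule has_derivative_f_chart[OF c])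
  have "((norm \<circ> ?\<phi>) has_derivative ((\<lambda>h. h \<bullet> sgn (f p)) \<circ> ?D)) (at ?x)"
    using has_derivative_norm[OF fp] \<phi> by (intro diff_chain_at) (simp_all add: chart_inv_chart[OF c])
  then have "((\<lambda>y. norm (?\<phi> y)) has_derivative (\<lambda>v. ?D v \<bullet> sgn (f p))) (at ?x)"
    by (simp only: o_def)
  moreover have "norm (?\<phi> ?x) \<noteq> 0" using fp \<phi>x by simp
  ultimately have "((\<lambda>y. inverse (norm (?\<phi> y))) has_derivative
      (\<lambda>v. - (inverse (norm (?\<phi> ?x)) * (?D v \<bullet> sgn (f p)) * inverse (norm (?\<phi> ?x))))) (at ?x)"
    by (intro Deriv.has_derivative_inverse)
  from has_derivative_scaleR[OF this \<phi>, unfolded \<phi>x]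
  have "((?\<tau> \<circ> chart_inv ?c) has_derivative
      (\<lambda>v. inverse ?n *\<^sub>R ?D v + (- (inverse ?n * (?D v \<bullet> sgn (f p)) * inverse ?n)) *\<^sub>R f p)) (at ?x)"
    by (simp add: o_def sgn_div_norm)
  then have der: "frechet_derivative (?\<tau> \<circ> chart_inv ?c) (at ?x) =
      (\<lambda>v. inverse ?n *\<^sub>R ?D v + (- (inverse ?n * (?D v \<bullet> sgn (f p)) * inverse ?n)) *\<^sub>R f p)"
    by (rule frechet_derivative_eq)
  have \<omega>: "magnetic_diff \<alpha> \<Omega> ?\<tau> ?c p =
      (\<chi> j. (\<i> * f p / of_real (?n ^ 3)) * (\<chi> j. complex_of_real (current ?c p $ j)) $ j)"
    unfolding vec_eq_iff
  proof
    fix j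
    let ?d = "?D (axis j 1)" and ?a = "\<alpha> ?c p $ j"
    have nn: "f p * cnj (f p) = of_real (?n ^ 2)" by (rule complex_norm_square[symmetric])
    have cur: "complex_of_real (current ?c p $ j) = of_real (Im (cnj (f p) * ?d)) + of_real (?n ^ 2) * of_real ?a"
      by (simp add: current_def re_components_def)
    \<comment> \<open>The radial part of the derivative; it cancels against the derivative of the
      modulus.\<close>
    define R where "R = Re (cnj (f p) * ?d)"
    have R: "?d \<bullet> sgn (f p) = R / ?n"
      by (simp add: R_def inner_complex_def sgn_div_norm field_simps add_divide_distrib)
    have "magnetic_diff \<alpha> \<Omega> ?\<tau> ?c p $ j =
        inverse ?n *\<^sub>R ?d + (- (inverse ?n * (R / ?n) * inverse ?n)) *\<^sub>R f p + \<i> * of_real ?a * sgn (f p)"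
      unfolding magnetic_diff_def at der by (simp add: R)
    also have "\<dots> = ?d / of_real ?n - of_real R * f p / of_real (?n ^ 3) + \<i> * of_real ?a * f p / of_real ?n"
      using n by (simp add: scaleR_conv_of_real sgn_eq field_simps power3_eq_cube)
    also have "?d / of_real ?n = f p * (cnj (f p) * ?d) / of_real (?n ^ 3)"
      using n nn by (simp add: mult.assoc[symmetric] power3_eq_cube power2_eq_square)
    also have "cnj (f p) * ?d = of_real R + \<i> * of_real (Im (cnj (f p) * ?d))"
      unfolding R_def by (rule complex_eq)
    finally show "magnetic_diff \<alpha> \<Omega> ?\<tau> ?c p $ j =
        (\<chi> j. (\<i> * f p / of_real (?n ^ 3)) * (\<chi> j. complex_of_real (current ?c p $ j)) $ j) $ j"
      using n unfolding vec_lambda_beta cur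
      by (simp add: field_simps power3_eq_cube power2_eq_square)
  qed
  have zero: "(\<chi> j. 0) = (0 :: real^'n)" by (simp add: vec_eq_iff)
  have "magnetic_norm \<A> g \<alpha> \<Omega> ?\<tau> p =
      cmod (\<i> * f p / of_real (?n ^ 3)) * covector_norm g ?c p (\<chi> j. complex_of_real (current ?c p $ j))"
    unfolding magnetic_norm_def \<omega> by (rule covector_norm_scale)
  also have "covector_norm g ?c p (\<chi> j. complex_of_real (current ?c p $ j)) = conorm current p"
    by (simp add: covector_norm_eq[of g ?c p, OF pd] zero conorm_def)
  also have "cmod (\<i> * f p / of_real (?n ^ 3)) = 1 / ?n\<^sup>2"
    using n by (simp add: norm_mult norm_divide norm_power power3_eq_cube power2_eq_square)
  finally show ?thesis by simp
qed

lemma smooth_fun_on_sgn_f: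
  assumes "\<And>p. p \<in> \<Omega> \<Longrightarrow> f p \<noteq> 0"
  shows "smooth_fun_on \<A> \<Omega> (\<lambda>p. sgn (f p))"
proof -
  let ?W = "{p. f p \<noteq> 0}"
  have "open (f -` (- {0}))"
    using continuous_on_f by (intro open_vimage) auto
  then have W: "open ?W" by (simp add: vimage_def)
  have "smooth_fun_on_open \<A> ?W (\<lambda>p. sgn (f p))"
    unfolding smooth_fun_on_open_def
  proof (intro conjI W ballI)
    fix c assume c: "c \<in> \<A>"
    have "smooth_on (snd c ` (fst c \<inter> ?W)) (f \<circ> chart_inv c)"
      using smooth_f_chart[OF c] unfolding smooth_on_def by (blast intro: Ck_on_subset)
    then have "smooth_on (snd c ` (fst c \<inter> ?W)) (\<lambda>y. sgn ((f \<circ> chart_inv c) y))"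
      by (rule smooth_on_sgn[OF open_chart_image[OF c W]]) (auto simp: chart_inv_chart[OF c])
    then show "smooth_on (snd c ` (fst c \<inter> ?W)) ((\<lambda>p. sgn (f p)) \<circ> chart_inv c)"
      by (simp add: o_def)
  qed
  then show ?thesis
    using assms unfolding smooth_fun_on_def by (intro ballI exI[of _ ?W] exI[of _ "\<lambda>p. sgn (f p)"]) auto
qed

section \<open>The co-area estimate\<close>

lemma superlevel_eq: "0 \<le> t \<Longrightarrow> superlevel f (sqrt t) = {p. t \<le> (cmod (f p))\<^sup>2}"
  by (auto simp: superlevel_def real_le_lsqrt sqrt_le_D)

text \<open>Off the null level \<open>F = t\<close>, every point of the superlevel set is interior,
  so the norm of the test map is known almost everywhere. The indicator is written in
  \<open>t\<close> to fit the integration over layers.\<close>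

lemma frustration_index_le:
  assumes t: "0 < t" and null: "AE p in vol. (cmod (f p))\<^sup>2 \<noteq> t"
  shows "frustration_index \<A> g \<alpha> (superlevel f (sqrt t)) \<le>
    (\<integral>\<^sup>+p. ennreal (conorm current p / (cmod (f p))\<^sup>2) * indicator {0<..(cmod (f p))\<^sup>2} t \<partial>vol)"
proof -
  let ?\<Omega> = "superlevel f (sqrt t)" and ?\<tau> = "\<lambda>p. sgn (f p)"
  have \<Omega>: "?\<Omega> = {p. t \<le> (cmod (f p))\<^sup>2}" using t by (intro superlevel_eq) simp
  then have nz: "f p \<noteq> 0" if "p \<in> ?\<Omega>" for p using that t by auto
  have "frustration_index \<A> g \<alpha> ?\<Omega> \<le> (\<integral>\<^sup>+p\<in>?\<Omega>. ennreal (magnetic_norm \<A> g \<alpha> ?\<Omega> ?\<tau> p) \<partial>vol)"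
    unfolding frustration_index_def
    by (rule INF_lower) (use nz smooth_fun_on_sgn_f in \<open>auto simp: norm_sgn\<close>)
  also have "\<dots> = (\<integral>\<^sup>+p. ennreal (conorm current p / (cmod (f p))\<^sup>2) * indicator {0<..(cmod (f p))\<^sup>2} t \<partial>vol)"
  proof (rule nn_integral_cong_AE)
    show "AE p in vol. ennreal (magnetic_norm \<A> g \<alpha> ?\<Omega> ?\<tau> p) * indicator ?\<Omega> p =
        ennreal (conorm current p / (cmod (f p))\<^sup>2) * indicator {0<..(cmod (f p))\<^sup>2} t"
      using null
    proof eventually_elim
      case (elim p)
      show ?case
      proof (cases "p \<in> ?\<Omega>")
        case True
        let ?W = "{p. t < (cmod (f p))\<^sup>2}"
        have "open ?W"
          using continuous_on_f by (intro open_Collect_less continuous_intros)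
        moreover have "p \<in> ?W" "?W \<subseteq> ?\<Omega>" using True elim by (auto simp: \<Omega>)
        ultimately show ?thesis
          using magnetic_norm_sgn[of ?W p ?\<Omega>] nz[OF True] True t \<Omega> by simp
      next
        case False
        then show ?thesis using \<Omega> by simp
      qed
    qed
  qed
  finally show ?thesis .
qed

text \<open>A point gained by the neighbourhood has a value below \<open>t\<close> that the growth
  estimate lifts to at least \<open>t\<close>, so it belongs to a thin layer. Monotonicity of the
  measure asks for measurability of the larger set, here a Borel set.\<close>

lemma neighbourhood_volume_le:
  assumes bound: "\<And>p q. riemannian_dist \<A> g p q < ennreal r \<Longrightarrow> (cmod (f q))\<^sup>2 \<le> (cmod (f p))\<^sup>2 + r * h p"
    and [measurable]: "h \<in> borel_measurable borel" and t: "0 \<le> t"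
  shows "emeasure vol (open_neighbourhood \<A> g r (superlevel f (sqrt t))) - emeasure vol (superlevel f (sqrt t))
    \<le> (\<integral>\<^sup>+p. 1 * indicator {(cmod (f p))\<^sup>2<..(cmod (f p))\<^sup>2 + r * h p} t \<partial>vol)"
proof -
  interpret finite_measure vol by (rule finite_measure_vol)
  let ?F = "\<lambda>p. (cmod (f p))\<^sup>2" and ?N = "open_neighbourhood \<A> g r (superlevel f (sqrt t))"
  let ?A = "{p. t \<le> ?F p + r * h p}" and ?B = "{p. t \<le> ?F p}" and ?C = "{p. ?F p < t \<and> t \<le> ?F p + r * h p}"
  have [measurable]: "?A \<in> sets borel" "?B \<in> sets borel" "?C \<in> sets borel" by measurable
  have \<Omega>: "superlevel f (sqrt t) = ?B" using t by (rule superlevel_eq)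
  have "?N \<subseteq> ?A"
    using bound unfolding open_neighbourhood_def \<Omega> by (fastforce intro: order_trans)
  then have "?N \<subseteq> ?C \<union> ?B" by auto
  then have "emeasure vol ?N \<le> emeasure vol (?C \<union> ?B)" by (intro emeasure_mono) auto
  also have "\<dots> \<le> emeasure vol ?C + emeasure vol ?B" by (intro emeasure_subadditive) auto
  finally have "emeasure vol ?N - emeasure vol ?B \<le> emeasure vol ?C + emeasure vol ?B - emeasure vol ?B"
    by (rule ennreal_minus_mono) simp
  also have "\<dots> = emeasure vol ?C" by simp
  also have "emeasure vol ?C = (\<integral>\<^sup>+p. indicator ?C p \<partial>vol)" by simp
  also have "\<dots> = (\<integral>\<^sup>+p. 1 * indicator {?F p<..?F p + r * h p} t \<partial>vol)"
    by (intro nn_integral_cong) (auto simp: indicator_def)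
  finally show ?thesis unfolding \<Omega> .
qed

lemma sum_integrals_le:
  assumes \<epsilon>: "0 < \<epsilon>"
  shows "(\<integral>\<^sup>+ t\<in>{0..}. (frustration_index \<A> g \<alpha> (superlevel f (sqrt t))
                       + boundary_area \<A> g (superlevel f (sqrt t))) \<partial>lborel)
    \<le> (\<integral>\<^sup>+p. ennreal (conorm current p) \<partial>vol) + (\<integral>\<^sup>+p. ennreal (conorm dF p + \<epsilon>) \<partial>vol)"
proof -
  interpret finite_measure vol by (rule finite_measure_vol)
  have sf: "sigma_finite_measure vol" by unfold_locales
  let ?F = "\<lambda>p. (cmod (f p))\<^sup>2"
  let ?h = "\<lambda>p. conorm dF p + \<epsilon>"
  obtain r0 where r0: "0 < r0" and bound: "\<And>p q r. r < r0 \<Longrightarrow> riemannian_dist \<A> g p q < ennreal r \<Longrightarrow>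
      ?F q \<le> ?F p + r * ?h p"
    using differential_bound_near[OF has_differential_dF \<epsilon>] by blast
  \<comment> \<open>The summand 2 keeps even \<open>r 0\<close> strictly below
    \<open>r0\<close>.\<close>
  define r where "r n = r0 / (real n + 2)" for n
  have r: "0 < r n" "r n < r0" for n using r0 by (simp_all add: r_def field_simps add_pos_nonneg)
  have "r \<longlonglongrightarrow> 0"
    unfolding r_def by (intro tendsto_divide_0[OF tendsto_const] filterlim_at_top_imp_at_infinity
        filterlim_tendsto_add_at_top[OF tendsto_const filterlim_real_sequentially, of 2, simplified add.commute])
  then have r_lim: "filterlim r (at_right 0) sequentially"
    using r(1) by (intro tendsto_imp_filterlim_at_right) auto
  define a where "a t = (\<integral>\<^sup>+p. ennreal (conorm current p / ?F p) * indicator {0<..?F p} t \<partial>vol)" for t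
  define b where "b n t = (\<integral>\<^sup>+p. 1 * indicator {?F p<..?F p + r n * ?h p} t \<partial>vol)" for n t
  have [measurable]: "a \<in> borel_measurable borel"
    using borel_measurable_layer[OF sf, of "\<lambda>_. 0" ?F "\<lambda>p. ennreal (conorm current p / ?F p)"]
    by (simp add: a_def[abs_def])
  have [measurable]: "b n \<in> borel_measurable borel" for n
    using borel_measurable_layer[OF sf, of ?F "\<lambda>p. ?F p + r n * ?h p" "\<lambda>_. 1"]
    by (simp add: b_def[abs_def])
  have area: "boundary_area \<A> g (superlevel f (sqrt t)) \<le> liminf (\<lambda>n. b n t / ennreal (r n))" if "0 \<le> t" for t
  proof -
    have "boundary_area \<A> g (superlevel f (sqrt t)) \<le> liminf (\<lambda>n.
        (emeasure vol (open_neighbourhood \<A> g (r n) (superlevel f (sqrt t)))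
          - emeasure vol (superlevel f (sqrt t))) / ennreal (r n))"
      unfolding boundary_area_def using r_lim by (rule Liminf_at_right_0_le)
    also have "\<dots> \<le> liminf (\<lambda>n. b n t / ennreal (r n))"
      using that bound[OF r(2)]
      unfolding b_def
      by (intro Liminf_mono always_eventually allI divide_right_mono_ennreal neighbourhood_volume_le) auto
    finally show ?thesis .
  qed
  have "AE t in lborel. AE p in vol. ?F p \<noteq> t" by (rule AE_level_null[OF sf]) simp
  moreover have "AE t in lborel. t \<noteq> (0::real)" by (rule AE_lborel_singleton)
  ultimately have "AE t in lborel. (frustration_index \<A> g \<alpha> (superlevel f (sqrt t))
      + boundary_area \<A> g (superlevel f (sqrt t))) * indicator {0..} t
      \<le> a t * indicator {0..} t + liminf (\<lambda>n. b n t / ennreal (r n)) * indicator {0..} t"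
  proof eventually_elim
    case (elim t)
    then show ?case
      using frustration_index_le[of t] area[of t]
      unfolding a_def by (cases "0 \<le> t") (auto intro: add_mono)
  qed
  then have "(\<integral>\<^sup>+ t\<in>{0..}. (frustration_index \<A> g \<alpha> (superlevel f (sqrt t))
      + boundary_area \<A> g (superlevel f (sqrt t))) \<partial>lborel)
      \<le> (\<integral>\<^sup>+ t. a t * indicator {0..} t + liminf (\<lambda>n. b n t / ennreal (r n)) * indicator {0..} t \<partial>lborel)"
    by (rule nn_integral_mono_AE)
  also have "\<dots> = (\<integral>\<^sup>+ t\<in>{0..}. a t \<partial>lborel) + (\<integral>\<^sup>+ t\<in>{0..}. liminf (\<lambda>n. b n t / ennreal (r n)) \<partial>lborel)"
    by (rule nn_integral_add) measurable
  also have "(\<integral>\<^sup>+ t\<in>{0..}. a t \<partial>lborel) = (\<integral>\<^sup>+p. ennreal (conorm current p / ?F p) * ennreal (?F p - 0) \<partial>vol)"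
    unfolding a_def by (rule nn_integral_layer[OF sf]) auto
  \<comment> \<open>The squared modulus from the layer length cancels the denominator; at zeros of
    \<open>f\<close> the product is 0.\<close>
  also have "\<dots> \<le> (\<integral>\<^sup>+p. ennreal (conorm current p) \<partial>vol)"
    by (intro nn_integral_mono) (auto simp: ennreal_mult''[symmetric])
  also have "(\<integral>\<^sup>+ t\<in>{0..}. liminf (\<lambda>n. b n t / ennreal (r n)) \<partial>lborel)
      \<le> (\<integral>\<^sup>+ t. liminf (\<lambda>n. b n t * indicator {0..} t / ennreal (r n)) \<partial>lborel)"
    by (intro nn_integral_mono) (auto simp: indicator_def)
  also have "\<dots> \<le> liminf (\<lambda>n. \<integral>\<^sup>+ t. b n t * indicator {0..} t / ennreal (r n) \<partial>lborel)"
    by (intro nn_integral_liminf) measurable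
  also have "(\<lambda>n. \<integral>\<^sup>+ t. b n t * indicator {0..} t / ennreal (r n) \<partial>lborel) =
      (\<lambda>n. \<integral>\<^sup>+p. ennreal (?h p) \<partial>vol)"
  proof
    fix n
    have "(\<integral>\<^sup>+ t. b n t * indicator {0..} t / ennreal (r n) \<partial>lborel) =
        (\<integral>\<^sup>+ t\<in>{0..}. b n t \<partial>lborel) / ennreal (r n)"
      by (rule nn_integral_divide) measurable
    also have "(\<integral>\<^sup>+ t\<in>{0..}. b n t \<partial>lborel) = (\<integral>\<^sup>+p. 1 * ennreal (?F p + r n * ?h p - ?F p) \<partial>vol)"
      unfolding b_def by (rule nn_integral_layer[OF sf]) auto
    also have "\<dots> / ennreal (r n) = (\<integral>\<^sup>+p. 1 * ennreal (?F p + r n * ?h p - ?F p) / ennreal (r n) \<partial>vol)"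
      by (rule nn_integral_divide[symmetric]) measurable
    \<comment> \<open>The layer has thickness \<open>r n * ?h p\<close>, so the quotient is
      independent of \<open>n\<close> and the lower limit is that of a constant.\<close>
    also have "\<dots> = (\<integral>\<^sup>+p. ennreal (?h p) \<partial>vol)"
      using r(1)[of n] \<epsilon> by (intro nn_integral_cong) (simp add: divide_ennreal)
    finally show "(\<integral>\<^sup>+ t. b n t * indicator {0..} t / ennreal (r n) \<partial>lborel) = (\<integral>\<^sup>+p. ennreal (?h p) \<partial>vol)" .
  qed
  finally show ?thesis by (simp add: Liminf_const add_mono)
qed

lemma integral_frustration_area_le:
  "(\<integral>\<^sup>+ t\<in>{0..}. (frustration_index \<A> g \<alpha> (superlevel f (sqrt t))
                       + boundary_area \<A> g (superlevel f (sqrt t))) \<partial>lborel)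
   \<le> ennreal (2 * sqrt 2) * (\<integral>\<^sup>+ p. ennreal (cmod (f p) * magnetic_norm \<A> g \<alpha> UNIV f p) \<partial>vol)"
  (is "?L \<le> _")
proof -
  interpret finite_measure vol by (rule finite_measure_vol)
  let ?I = "(\<integral>\<^sup>+p. ennreal (conorm current p) \<partial>vol) + (\<integral>\<^sup>+p. ennreal (conorm dF p) \<partial>vol)"
  have "?L \<le> ?I"
  proof (rule ennreal_le_epsilon)
    fix e :: real assume e: "0 < e"
    \<comment> \<open>The summand 1 keeps the denominator positive whatever the total
      volume.\<close>
    define \<epsilon> where "\<epsilon> = e / (measure vol UNIV + 1)"
    have \<epsilon>: "0 < \<epsilon>" "\<epsilon> * measure vol UNIV \<le> e"
      using e by (auto simp: \<epsilon>_def divide_simps add_nonneg_pos measure_nonneg intro!: mult_left_mono)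
    have "(\<integral>\<^sup>+p. ennreal (conorm dF p + \<epsilon>) \<partial>vol) = (\<integral>\<^sup>+p. ennreal (conorm dF p) + ennreal \<epsilon> \<partial>vol)"
      using \<epsilon>(1) by (simp add: ennreal_plus)
    also have "\<dots> = (\<integral>\<^sup>+p. ennreal (conorm dF p) \<partial>vol) + (\<integral>\<^sup>+p. ennreal \<epsilon> \<partial>vol)"
      by (rule nn_integral_add) measurable
    also have "(\<integral>\<^sup>+p. ennreal \<epsilon> \<partial>vol) = ennreal (\<epsilon> * measure vol UNIV)"
      using \<epsilon>(1) by (simp add: emeasure_eq_measure ennreal_mult)
    also have "\<dots> \<le> ennreal e" using \<epsilon>(2) by (rule ennreal_leI)
    finally have "(\<integral>\<^sup>+p. ennreal (conorm dF p + \<epsilon>) \<partial>vol) \<le> (\<integral>\<^sup>+p. ennreal (conorm dF p) \<partial>vol) + ennreal e"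
      by (simp add: add_mono)
    from order_trans[OF sum_integrals_le[OF \<epsilon>(1)] add_left_mono[OF this]]
    show "?L \<le> ?I + ennreal e" by (simp only: add.assoc)
  qed
  also have "?I = (\<integral>\<^sup>+p. ennreal (conorm current p) + ennreal (conorm dF p) \<partial>vol)"
    by (rule nn_integral_add[symmetric]) measurable
  also have "\<dots> \<le> (\<integral>\<^sup>+p. ennreal (2 * sqrt 2) * ennreal (cmod (f p) * magnetic_norm \<A> g \<alpha> UNIV f p) \<partial>vol)"
  proof (rule nn_integral_mono)
    fix p
    let ?v = "conorm current p" and ?d = "conorm dF p"
    \<comment> \<open>The origin of \<open>2 * sqrt 2\<close>, the square root of 8: the squared sum
      is at most twice the sum of squares, and \<open>?d\<^sup>2\<close> is four times
      \<open>?d\<^sup>2 / 4\<close>. The best constant in this pointwise inequality would be the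
      square root of 5.\<close>
    have "?v + ?d \<le> sqrt (8 * (?d\<^sup>2 / 4 + ?v\<^sup>2))"
    proof (rule real_le_rsqrt)
      have "8 * (?d\<^sup>2 / 4 + ?v\<^sup>2) = (?v + ?d)\<^sup>2 + (?d - ?v)\<^sup>2 + 6 * ?v\<^sup>2"
        by (simp add: power2_eq_square algebra_simps)
      then show "(?v + ?d)\<^sup>2 \<le> 8 * (?d\<^sup>2 / 4 + ?v\<^sup>2)"
        using zero_le_power2[of "?d - ?v"] zero_le_power2[of ?v] by linarith
    qed
    also have "\<dots> = 2 * sqrt 2 * (cmod (f p) * magnetic_norm \<A> g \<alpha> UNIV f p)"
      unfolding magnetic_norm_f real_sqrt_mult using real_sqrt_mult[of 4 2] by simp
    finally show "ennreal ?v + ennreal ?d \<le>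
        ennreal (2 * sqrt 2) * ennreal (cmod (f p) * magnetic_norm \<A> g \<alpha> UNIV f p)"
      by (simp add: ennreal_plus[symmetric] ennreal_mult'[symmetric] ennreal_leI del: ennreal_plus)
  qed
  also have "\<dots> = ennreal (2 * sqrt 2) * (\<integral>\<^sup>+ p. ennreal (cmod (f p) * magnetic_norm \<A> g \<alpha> UNIV f p) \<partial>vol)"
    unfolding magnetic_norm_f by (rule nn_integral_cmult) measurable
  finally show ?thesis .
qed

end

theorem lemma7p5:
  fixes \<A> :: "('m::{t2_space, second_countable_topology}, 'n::finite) chart set"
    and g :: "('m, 'n) metric"
    and \<alpha> :: "('m, 'n) one_form"
    and f :: "'m \<Rightarrow> complex"
  assumes "smooth_atlas \<A>"
    and "compact (UNIV :: 'm set)"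
    and "connected (UNIV :: 'm set)"
    and "riemannian_metric \<A> g"
    and "smooth_one_form \<A> \<alpha>"
    and "smooth_fun_on \<A> UNIV f"
    and "\<exists>p. f p \<noteq> 0"
  shows "(\<integral>\<^sup>+ t\<in>{0..}. (frustration_index \<A> g \<alpha> (superlevel f (sqrt t))
                       + boundary_area \<A> g (superlevel f (sqrt t))) \<partial>lborel)
         \<le> ennreal (2 * sqrt 2) *
            (\<integral>\<^sup>+ p. ennreal (cmod (f p) * magnetic_norm \<A> g \<alpha> UNIV f p) \<partial>riemannian_measure \<A> g)"
proof -
  interpret magnetic_riemannian \<A> g \<alpha> f
    using assms by unfold_locales
  show ?thesis by (rule integral_frustration_area_le)
qed

end
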